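(* The number $\mathrm{mgs}(G)$ of vertices in a minimum geodetic set of a series-parallel digraph $G$ can be computed recursively, together with $\mathrm{sp}(G)$ and $\mathrm{cmgs}(G)$, by the following rules, i.e. the following equalities hold. 1. For the initial series-parallel digraph $I_{(s,t)}$: (a) $\mathrm{sp}(I_{(s,t)})=1$, (b) $\mathrm{mgs}(I_{(s,t)})=2$, (c) $\mathrm{cmgs}(I_{(s,t)})=2$. 2. For the series composition $G\updownarrow G'$ of two series-parallel digraphs $G$ and $G'$: (a) $\mathrm{sp}(G\updownarrow G')=\mathrm{sp}(G)+\mathrm{sp}(G')$; (b) $\mathrm{mgs}(G\updownarrow G')=\mathrm{mgs}(G)+\mathrm{mgs}(G')-2$; (c) $\mathrm{cmgs}(G\updownarrow G')=\mathrm{mgs}(G)+\mathrm{mgs}(G')-2$ if [$\mathrm{mgs}(G)>2$ and $\mathrm{mgs}(G')>2$] or [$\mathrm{mgs}(G)=\mathrm{cmgs}(G)>2$] or [$\mathrm{mgs}(G')=\mathrm{cmgs}(G')>2$]; and $\mathrm{cmgs}(G\updownarrow G')=\mathrm{mgs}(G)+\mathrm{mgs}(G')-1$ otherwise. 3. For the parallel composition $G\leftrightarrow G'$ of two series-parallel digraphs $G$ and $G'$: (a) $\mathrm{sp}(G\leftrightarrow G')=\min\{\mathrm{sp}(G),\mathrm{sp}(G')\}$; (b) $\mathrm{mgs}(G\leftrightarrow G')=\begin{cases}\mathrm{mgs}(G)+\mathrm{mgs}(G')-2 & \text{if } \mathrm{sp}(G)=\mathrm{sp}(G'),\\ \mathrm{mgs}(G)+\mathrm{cmgs}(G')-2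 & \text{if } \mathrm{sp}(G)<\mathrm{sp}(G'),\\ \mathrm{cmgs}(G)+\mathrm{mgs}(G')-2 & \text{if } \mathrm{sp}(G)>\mathrm{sp}(G');\end{cases}$ (c) $\mathrm{cmgs}(G\leftrightarrow G')=\mathrm{cmgs}(G)+\mathrm{cmgs}(G')-2$.
   Context: Directed graphs are finite, with edge set $E\subseteq V\times V$ (so no multiple edges). The length of a path is the number of its edges; a shortest path from $u$ to $v$ is a directed path from $u$ to $v$ of minimum length; the single-vertex path is a shortest path from a vertex to itself. Series-parallel digraphs. For $E\subseteq V\times V$ and $u',u\in V$ let $\mathrm{merge}_{u'\to u}(E)=\{(v,w)\mid v\ne u',\ w\neq u',\ (v,w)\in E\}\cup\{(v,u)\mid v\ne u',\ (v,u')\in E\}\cup\{(u,w)\mid w\ne u',\ (u',w)\in E\}$. Series-parallel digraphs are systems $G=(V,E,s,t)$, with $(V,E)$ a directed graph and $s\ne t$ in $V$ (source vertex $s$, target vertex $t$), generated recursively as follows. - $I_{(s,t)}=(\{s,t\},\{(s,t)\},s,t)$ is a series-parallel digraph (the initial series-parallel digraph). - If $G=(V,E,s,t)$ and $G'=(V',E',s',t')$ are series-parallel digraphs (with $V\cap V'=\emptyset$), then so are: the series composition $G\updownarrow G'$, with vertex set $(V\cup V')\setminus\{s'\}$, edge set $\mathrm{merge}_{s'\to t}(E\cup E')$, source $s$, target $t'$; and the parallel composition $G\leftrightarrow G'$, with vertex set $(V\cup V')\setminus\{s',t'\}$, edge set $\mathrm{merge}_{s'\to s}(\mathrm{merge}_{t'\to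 t}(E\cup E'))$, source $s$, target $t$. A set $S\subseteq V$ is a geodetic set of $G$ if every vertex of $V$ lies on a shortest path from a vertex of $S$ to a vertex of $S$. A set $S\subseteq V$ is a closed geodetic set of $G=(V,E,s,t)$ if every vertex $w\in V\setminus S$ lies on a shortest path from a vertex $u\in S$ to a vertex $v\in S$ such that $u\neq s$ or $v\ne t$. $\mathrm{mgs}(G)$ is the minimum number of vertices of a geodetic set of $G$, $\mathrm{cmgs}(G)$ is the minimum number of vertices of a closed geodetic set of $G$, and $\mathrm{sp}(G)$ is the length of a shortest path from the source $s$ to the target $t$ in $G$. *)

theory Defs
  imports "Graph_Theory.Pair_Digraph" "Graph_Theory.Vertex_Walk"
begin

record 'a st_digraph =
  dgraph :: "'a pair_pre_digraph"
  source :: 'a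
  target :: 'a

definition merge :: "'a \<Rightarrow> 'a \<Rightarrow> 'a rel \<Rightarrow> 'a rel" where
  "merge u' u E =
     {(v, w) | v w. v \<noteq> u' \<and> w \<noteq> u' \<and> (v, w) \<in> E}
     \<union> {(v, u) | v. v \<noteq> u' \<and> (v, u') \<in> E}
     \<union> {(u, w) | w. w \<noteq> u' \<and> (u', w) \<in> E}"

definition initial_spd :: "'a \<Rightarrow> 'a \<Rightarrow> 'a st_digraph" where
  "initial_spd s t =
     \<lparr> dgraph = \<lparr> pverts = {s, t}, parcs = {(s, t)} \<rparr>, source = s, target = t \<rparr>"

definition series_comp :: "'a st_digraph \<Rightarrow> 'a st_digraph \<Rightarrow> 'a st_digraph" where
  "series_comp G G' =
     \<lparr> dgraph = \<lparr>
         pverts = (pverts (dgraph G) \<union> pverts (dgraph G')) - {source G'},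
         parcs = merge (source G') (target G) (parcs (dgraph G) \<union> parcs (dgraph G')) \<rparr>,
       source = source G, target = target G' \<rparr>"

definition parallel_comp :: "'a st_digraph \<Rightarrow> 'a st_digraph \<Rightarrow> 'a st_digraph" where
  "parallel_comp G G' =
     \<lparr> dgraph = \<lparr>
         pverts = (pverts (dgraph G) \<union> pverts (dgraph G')) - {source G', target G'},
         parcs = merge (source G') (source G)
                   (merge (target G') (target G) (parcs (dgraph G) \<union> parcs (dgraph G'))) \<rparr>,
       source = source G, target = target G \<rparr>"

inductive sp_digraph :: "'a st_digraph \<Rightarrow> bool" where
  initial: "s \<noteq> t \<Longrightarrow> sp_digraph (initial_spd s t)"
| series: "sp_digraph G \<Longrightarrow> sp_digraph G' \<Longrightarrow> pverts (dgraph G) \<inter> pverts (dgraph G') = {} \<Longrightarrow>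
    sp_digraph (series_comp G G')"
| parallel: "sp_digraph G \<Longrightarrow> sp_digraph G' \<Longrightarrow> pverts (dgraph G) \<inter> pverts (dgraph G') = {} \<Longrightarrow>
    sp_digraph (parallel_comp G G')"

text \<open>Every system generated by these rules is a finite digraph with two distinct
  distinguished vertices; in particular \<^const>\<open>card\<close> is used below on finite sets only.\<close>

lemma sp_digraph_wf:
  assumes "sp_digraph G"
  shows "pair_fin_digraph (dgraph G)"
    and "source G \<in> pverts (dgraph G)"
    and "target G \<in> pverts (dgraph G)"
    and "source G \<noteq> target G"
proof -
  have "finite (pverts (dgraph G)) \<and> parcs (dgraph G) \<subseteq> pverts (dgraph G) \<times> pverts (dgraph G)
    \<and> source G \<in> pverts (dgraph G) \<and> target G \<in> pverts (dgraph G) \<and> source G \<noteq> target G"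
    using assms
  proof induction
    case (initial s t)
    then show ?case by (simp add: initial_spd_def)
  next
    case (series G G')
    then show ?case unfolding series_comp_def merge_def by auto
  next
    case (parallel G G')
    then show ?case unfolding parallel_comp_def merge_def by auto
  qed
  then show "pair_fin_digraph (dgraph G)" "source G \<in> pverts (dgraph G)"
    "target G \<in> pverts (dgraph G)" "source G \<noteq> target G"
    by (auto intro!: pair_fin_digraph.intro pair_wf_digraph.intro
        pair_fin_digraph_axioms.intro intro: finite_subset)
qed

definition shortest_path :: "'a pair_pre_digraph \<Rightarrow> 'a \<Rightarrow> 'a list \<Rightarrow> 'a \<Rightarrow> bool" where
  "shortest_path D u p v \<longleftrightarrow>
     vpath p (with_proj D) \<and> hd p = u \<and> last p = v \<and>
     (\<forall>q. vpath q (with_proj D) \<and> hd q = u \<and> last q = v \<longrightarrow> vwalk_length p \<le> vwalk_length q)"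

definition geodetic_set :: "'a pair_pre_digraph \<Rightarrow> 'a set \<Rightarrow> bool" where
  "geodetic_set D S \<longleftrightarrow> S \<subseteq> pverts D \<and>
     (\<forall>w \<in> pverts D. \<exists>u \<in> S. \<exists>v \<in> S. \<exists>p. shortest_path D u p v \<and> w \<in> set p)"

definition closed_geodetic_set :: "'a st_digraph \<Rightarrow> 'a set \<Rightarrow> bool" where
  "closed_geodetic_set G S \<longleftrightarrow> S \<subseteq> pverts (dgraph G) \<and>
     (\<forall>w \<in> pverts (dgraph G) - S. \<exists>u \<in> S. \<exists>v \<in> S. (u \<noteq> source G \<or> v \<noteq> target G) \<and>
        (\<exists>p. shortest_path (dgraph G) u p v \<and> w \<in> set p))"

definition mgs :: "'a st_digraph \<Rightarrow> nat" where
  "mgs G = (LEAST n. \<exists>S. geodetic_set (dgraph G) S \<and> card S = n)"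

definition cmgs :: "'a st_digraph \<Rightarrow> nat" where
  "cmgs G = (LEAST n. \<exists>S. closed_geodetic_set G S \<and> card S = n)"

text \<open>All shortest paths from source to target have the same length, so \<open>LEAST\<close> only selects it.\<close>

definition sp :: "'a st_digraph \<Rightarrow> nat" where
  "sp G = (LEAST n. \<exists>p. shortest_path (dgraph G) (source G) p (target G) \<and> vwalk_length p = n)"

end

theory Submission
  imports Defs
begin

text \<open>
  Of a shortest path from \<open>u\<close> to \<open>v\<close> through \<open>w\<close> only three facts matter: \<open>w\<close> is reached
  from \<open>u\<close> in \<open>n\<close> steps, \<open>v\<close> from \<open>w\<close> in \<open>k\<close> steps, and \<open>n + k\<close> is the distance from \<open>u\<close> to \<open>v\<close>.
  So paths are replaced by powers of the edge relation (\<open>on_geodesic\<close>). Geodetic and closed geodetic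
  sets are then the two instances of one notion (\<open>cover\<close>), with a Boolean flag that forbids the pair
  of source and target as end points; \<open>mgs\<close> and \<open>cmgs\<close> are the two values of \<open>cover_number\<close>.

  No edge enters the source of a series-parallel digraph and none leaves its target, and every vertex
  lies on a walk from the source to the target. These facts (\<open>two_terminal\<close>) are preserved by both
  compositions and carry the whole argument. Because no edge enters the source, the source
  starts every shortest path that contains it, so it belongs to every cover; likewise the target.

  Parallel composition. A walk cannot change sides, since it could do so only at the source or the
  target, which are never inner vertices of a walk. A vertex other than the terminals is therefore
  covered exactly by the shortest paths of its own side, except that a shortest path from source to
  target of one side survives only if the other side has no shorter one. Hence \<open>S\<close> is a cover iff its
  two traces are covers, where the strictly longer side needs a closed one
  (\<open>parallel_join.cover_iff\<close>), and the sizes add up with the two shared terminals counted once.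

  Series composition. Every walk that changes sides passes the shared vertex \<open>m\<close>. A cover
  of the composition, cut at \<open>m\<close> and with \<open>m\<close> added, gives a geodetic set on each side. Conversely,
  two geodetic sets may be united and \<open>m\<close> dropped, since a shortest path that ends in \<open>m\<close> extends to
  the target of the second part. For closed sets that extension is a problem when it produces the
  forbidden pair of terminals, and this is avoided in three ways: the trace on the first side is
  itself closed, or the second side offers another end point besides its terminals, or \<open>m\<close> is kept.
  Together with the mirror image, and with the requirement that \<open>m\<close> itself be covered if it is
  dropped, this is \<open>series_join.cover_glue\<close>; the case distinction for \<open>cmgs\<close> says exactly when
  two minimum geodetic sets can be chosen such that \<open>m\<close> may be dropped.

  Both compositions are stated for digraphs that already overlap in the shared terminals. The
  merging of vertices in the original definitions is an injective renaming of the second operand,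
  which changes none of the three numbers.
\<close>

section \<open>Shortest paths as powers of the edge relation\<close>

definition is_dist :: "'a rel \<Rightarrow> 'a \<Rightarrow> 'a \<Rightarrow> nat \<Rightarrow> bool" where
  "is_dist E u v n \<longleftrightarrow> (u, v) \<in> E ^^ n \<and> (\<forall>k. (u, v) \<in> E ^^ k \<longrightarrow> n \<le> k)"

definition on_geodesic :: "'a rel \<Rightarrow> 'a \<Rightarrow> 'a \<Rightarrow> 'a \<Rightarrow> bool" where
  "on_geodesic E u w v \<longleftrightarrow> (\<exists>n m. (u, w) \<in> E ^^ n \<and> (w, v) \<in> E ^^ m \<and> is_dist E u v (n + m))"

lemma relpow_if_vwalk:
  assumes "vwalk p (with_proj D)"
  shows "(hd p, last p) \<in> parcs D ^^ (length p - 1)"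
  using assms
proof (induction p rule: list.induct)
  case (Cons x xs)
  show ?case
  proof (cases xs)
    case xs: (Cons y ys)
    then have "(x, y) \<in> parcs D" "vwalk xs (with_proj D)"
      using Cons.prems by (auto simp: vwalk_def)
    then have "(x, last xs) \<in> parcs D ^^ Suc (length ys)"
      using Cons.IH xs by (intro relpow_Suc_I2) auto
    then show ?thesis using xs by simp
  qed simp
qed (simp add: vwalk_def)

lemma vwalk_if_relpow:
  assumes "(u, v) \<in> parcs D ^^ n" "u \<in> pverts D" "parcs D \<subseteq> pverts D \<times> pverts D"
  shows "\<exists>p. vwalk p (with_proj D) \<and> hd p = u \<and> last p = v \<and> length p = Suc n"
  using assms(1,2)
proof (induction n arbitrary: u)
  case 0
  then show ?case by (intro exI[of _ "[u]"]) (auto simp: vwalk_def)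
next
  case (Suc n)
  then obtain y where y: "(u, y) \<in> parcs D" "(y, v) \<in> parcs D ^^ n"
    by (blast elim: relpow_Suc_E2)
  then have "y \<in> pverts D" using assms(3) by blast
  then obtain p where p: "vwalk p (with_proj D)" "hd p = y" "last p = v" "length p = Suc n"
    using Suc.IH y by blast
  then have "vwalk (u # p) (with_proj D)"
    using Suc.prems y by (intro vwalk_consI) auto
  with p show ?case by (intro exI[of _ "u # p"]) auto
qed

text \<open>Cutting the cycles out of a walk shortens it unless the walk is a path already. So paths and walks
  have the same minimum length, and a walk of minimum length is a path.\<close>
lemma length_vwalk_to_vpath:
  "vwalk_to_vpath xs = xs \<or> length (vwalk_to_vpath xs) < length xs"
proof (induction xs rule: vwalk_to_vpath_induct3)
  case (in_set x xs)
  have "length (dropWhile (\<lambda>y. y \<noteq> x) xs) \<le> length xs"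
    by (rule length_dropWhile_le)
  with in_set show ?case by (auto simp: less_Suc_eq_le)
qed auto

lemma is_dist_if_shortest_path:
  assumes "shortest_path D u p v" "parcs D \<subseteq> pverts D \<times> pverts D"
  shows "is_dist (parcs D) u v (length p - 1)"
  unfolding is_dist_def
proof (intro conjI allI impI)
  have p: "vwalk p (with_proj D)" "hd p = u" "last p = v"
    using assms by (auto simp: shortest_path_def vpath_def)
  show "(u, v) \<in> parcs D ^^ (length p - 1)"
    using relpow_if_vwalk[OF p(1)] p by simp
  have "u \<in> pverts D" using p by (cases p) (auto simp: vwalk_def)
  fix k assume "(u, v) \<in> parcs D ^^ k"
  with \<open>u \<in> pverts D\<close> obtain q where q: "vwalk q (with_proj D)" "hd q = u" "last q = v" "length q = Suc k"
    using vwalk_if_relpow assms(2) by metis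
  define r where "r = vwalk_to_vpath q"
  have "vpath r (with_proj D)" "hd r = u" "last r = v"
    using q by (auto simp: r_def vwalk_to_vpath_hd vwalk_to_vpath_last intro: vwalk_to_vpath_vpath)
  then have "length p - 1 \<le> length r - 1"
    using assms(1) by (auto simp: shortest_path_def)
  moreover have "length r \<le> length q"
    using length_vwalk_to_vpath[of q] by (auto simp: r_def)
  ultimately show "length p - 1 \<le> k" using q by simp
qed

lemma shortest_path_if_vwalk:
  assumes "vwalk p (with_proj D)" "hd p = u" "last p = v" "is_dist (parcs D) u v (length p - 1)"
  shows "shortest_path D u p v"
proof -
  define r where "r = vwalk_to_vpath p"
  have r: "vpath r (with_proj D)" "hd r = u" "last r = v"
    using assms by (auto simp: r_def vwalk_to_vpath_hd vwalk_to_vpath_last intro: vwalk_to_vpath_vpath)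
  have min: "length p - 1 \<le> length q - 1"
    if "vpath q (with_proj D)" "hd q = u" "last q = v" for q
    using relpow_if_vwalk[of q D] that assms(4) by (auto simp: is_dist_def vpath_def)
  have "r \<noteq> []" using r by (auto simp: vpath_def vwalk_def)
  then have "r = p"
    using min[OF r] length_vwalk_to_vpath[of p] by (cases r) (auto simp: r_def)
  then show ?thesis using r min by (auto simp: shortest_path_def)
qed

text \<open>This lemma and the next translate the two list-based notions, length of a shortest path and
  incidence with a shortest path, into relation powers.\<close>
lemma ex_shortest_path_length_iff:
  assumes "parcs D \<subseteq> pverts D \<times> pverts D" "u \<in> pverts D"
  shows "(\<exists>p. shortest_path D u p v \<and> vwalk_length p = n) \<longleftrightarrow> is_dist (parcs D) u v n"
proof
  assume "is_dist (parcs D) u v n"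
  moreover then obtain p where "vwalk p (with_proj D)" "hd p = u" "last p = v" "length p = Suc n"
    using vwalk_if_relpow assms unfolding is_dist_def by metis
  ultimately show "\<exists>p. shortest_path D u p v \<and> vwalk_length p = n"
    using shortest_path_if_vwalk[of p D u v] by auto
qed (use is_dist_if_shortest_path assms in auto)

lemma ex_shortest_path_through_iff:
  assumes "parcs D \<subseteq> pverts D \<times> pverts D" "u \<in> pverts D"
  shows "(\<exists>p. shortest_path D u p v \<and> w \<in> set p) \<longleftrightarrow> on_geodesic (parcs D) u w v"
proof
  assume "\<exists>p. shortest_path D u p v \<and> w \<in> set p"
  then obtain p where p: "shortest_path D u p v" "w \<in> set p" by blast
  then obtain xs ys where split: "p = xs @ w # ys" by (meson split_list)
  have wk: "vwalk p (with_proj D)" "hd p = u" "last p = v"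
    using p by (auto simp: shortest_path_def vpath_def)
  then have "vwalk (xs @ [w]) (with_proj D)" "vwalk (w # ys) (with_proj D)"
    using vwalkI_append_l[of "xs @ [w]" ys] vwalkI_append_r[of "w # ys" xs] split by auto
  then have "(u, w) \<in> parcs D ^^ length xs" "(w, v) \<in> parcs D ^^ length ys"
    using relpow_if_vwalk[of "xs @ [w]" D] relpow_if_vwalk[of "w # ys" D] wk split
    by (auto simp: hd_append split: if_splits)
  moreover have "is_dist (parcs D) u v (length xs + length ys)"
    using is_dist_if_shortest_path[OF p(1) assms(1)] split by simp
  ultimately show "on_geodesic (parcs D) u w v"
    unfolding on_geodesic_def by blast
next
  assume "on_geodesic (parcs D) u w v"
  then obtain n m where nm: "(u, w) \<in> parcs D ^^ n" "(w, v) \<in> parcs D ^^ m"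
    "is_dist (parcs D) u v (n + m)" unfolding on_geodesic_def by blast
  obtain p where p: "vwalk p (with_proj D)" "hd p = u" "last p = w" "length p = Suc n"
    using vwalk_if_relpow[OF nm(1) assms(2,1)] by blast
  then have "w \<in> pverts D" by (auto simp: vwalk_def)
  then obtain q where q: "vwalk q (with_proj D)" "hd q = w" "last q = v" "length q = Suc m"
    using vwalk_if_relpow[OF nm(2) _ assms(1)] by blast
  have ne: "p \<noteq> []" "q \<noteq> []" using p q by auto
  have j: "joinable p q" using ne p q by (auto simp: joinable_def)
  have "vwalk (vwalk_join p q) (with_proj D)" "hd (vwalk_join p q) = u" "last (vwalk_join p q) = v"
    using p q j ne by (auto simp: vwalk_join_hd vwalk_join_last intro: vwalk_joinI_vwalk)
  moreover have "length (vwalk_join p q) - 1 = n + m"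
    using p q by (simp add: vwalk_join_def)
  ultimately have "shortest_path D u (vwalk_join p q) v"
    using nm(3) shortest_path_if_vwalk by metis
  moreover have "w \<in> set (vwalk_join p q)"
    using p ne by (auto simp: vwalk_join_def)
  ultimately show "\<exists>p. shortest_path D u p v \<and> w \<in> set p" by blast
qed

section \<open>Covers of two-terminal digraphs\<close>

abbreviation (input) vertices :: "'a st_digraph \<Rightarrow> 'a set" where
  "vertices G \<equiv> pverts (dgraph G)"

abbreviation (input) edges :: "'a st_digraph \<Rightarrow> 'a rel" where
  "edges G \<equiv> parcs (dgraph G)"

text \<open>The flag \<open>b\<close> selects closed geodetic sets. Only vertices outside \<open>S\<close> have to be covered, also for
  \<open>b = False\<close>: a vertex of \<open>S\<close> lies on the shortest path from itself to itself.\<close>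
definition cover :: "bool \<Rightarrow> 'a st_digraph \<Rightarrow> 'a set \<Rightarrow> bool" where
  "cover b G S \<longleftrightarrow> S \<subseteq> vertices G \<and>
     (\<forall>w \<in> vertices G - S. \<exists>u \<in> S. \<exists>v \<in> S. (b \<longrightarrow> u \<noteq> source G \<or> v \<noteq> target G) \<and>
        on_geodesic (edges G) u w v)"

definition cover_number :: "bool \<Rightarrow> 'a st_digraph \<Rightarrow> nat" where
  "cover_number b G = (LEAST n. \<exists>S. cover b G S \<and> card S = n)"

lemma is_dist_unique: "is_dist E u v n \<Longrightarrow> is_dist E u v m \<Longrightarrow> n = m"
  by (meson is_dist_def order_antisym)

lemma ex_is_dist: "(u, v) \<in> E\<^sup>* \<Longrightarrow> \<exists>n. is_dist E u v n"
  unfolding is_dist_def rtrancl_power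
  using LeastI_ex[of "\<lambda>n. (u, v) \<in> E ^^ n"] Least_le[of "\<lambda>n. (u, v) \<in> E ^^ n"] by blast

lemma on_geodesic_refl: "on_geodesic E u u u"
  unfolding on_geodesic_def is_dist_def by (intro exI[of _ 0]) auto

lemma on_geodesic_end:
  assumes "(u, v) \<in> E\<^sup>*"
  shows "on_geodesic E u v v"
proof -
  obtain n where "is_dist E u v n" using ex_is_dist[OF assms] by blast
  then show ?thesis
    unfolding on_geodesic_def by (intro exI[of _ n] exI[of _ 0]) (auto simp: is_dist_def)
qed

lemma relpow_in_verts:
  fixes E :: "'a rel"
  assumes "(u, v) \<in> E ^^ n" "E \<subseteq> V \<times> V"
  shows "u \<in> V \<longleftrightarrow> v \<in> V"
  using assms by (induction n arbitrary: v) auto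

lemma relpow_SucD:
  fixes E :: "'a rel"
  assumes "(u, v) \<in> E ^^ n" "n > 0"
  shows "\<exists>x y. (u, x) \<in> E \<and> (y, v) \<in> E"
proof -
  obtain m where "(u, v) \<in> E ^^ Suc m" using assms by (cases n) auto
  then show ?thesis by (meson relpow_Suc_D2 relpow_Suc_E)
qed

lemma relpow_converse:
  fixes E :: "'a rel"
  shows "(u, v) \<in> (E\<inverse>) ^^ n \<longleftrightarrow> (v, u) \<in> E ^^ n"
proof (induction n arbitrary: u v)
  case (Suc n)
  have "(u, v) \<in> (E\<inverse>) ^^ Suc n \<longleftrightarrow> (\<exists>x. (v, x) \<in> E \<and> (x, u) \<in> E ^^ n)"
    using Suc by auto
  also have "\<dots> \<longleftrightarrow> (v, u) \<in> E ^^ Suc n"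
    by (meson relpow_Suc_D2 relpow_Suc_I2)
  finally show ?case .
qed auto

lemma on_geodesic_converse: "on_geodesic (E\<inverse>) u w v \<longleftrightarrow> on_geodesic E v w u"
  unfolding on_geodesic_def is_dist_def relpow_converse
  by (subst ex_comm) (simp add: add.commute conj_commute conj_left_commute)

lemma relpow_mono_rel:
  fixes E F :: "'a rel"
  assumes "E \<subseteq> F" "(u, v) \<in> E ^^ n"
  shows "(u, v) \<in> F ^^ n"
  using assms(2,1) by (induction n arbitrary: v) auto

lemma cover_mono: "cover True G S \<Longrightarrow> cover b G S"
  unfolding cover_def by blast

lemma cover_subset: "cover b G S \<Longrightarrow> S \<subseteq> vertices G"
  by (simp add: cover_def)

lemma coverD:
  assumes "cover b G S" "w \<in> vertices G" "w \<notin> S"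
  shows "\<exists>u\<in>S. \<exists>v\<in>S. (b \<longrightarrow> u \<noteq> source G \<or> v \<noteq> target G) \<and> on_geodesic (edges G) u w v"
  using assms unfolding cover_def by blast

lemma cover_verts: "cover b G (vertices G)"
  by (auto simp: cover_def)

lemma cover_number_le: "cover b G S \<Longrightarrow> cover_number b G \<le> card S"
  unfolding cover_number_def by (rule Least_le) blast

lemma ex_minimum_cover: "\<exists>S. cover b G S \<and> card S = cover_number b G"
  unfolding cover_number_def by (rule LeastI_ex) (use cover_verts in blast)

lemma cover_number_mono: "cover_number b G \<le> cover_number True G"
  by (metis ex_minimum_cover cover_mono cover_number_le)

text \<open>Reversing all edges exchanges source and target, and the two operands of a series composition.
  Covers do not notice, so each statement about the second operand follows from the one about the
  first.\<close>
definition rev_st :: "'a st_digraph \<Rightarrow> 'a st_digraph" where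
  "rev_st G = \<lparr> dgraph = \<lparr> pverts = vertices G, parcs = (edges G)\<inverse> \<rparr>,
     source = target G, target = source G \<rparr>"

lemma rev_st_simps [simp]:
  "vertices (rev_st G) = vertices G" "edges (rev_st G) = (edges G)\<inverse>"
  "source (rev_st G) = target G" "target (rev_st G) = source G"
  by (simp_all add: rev_st_def)

lemma cover_rev_st [simp]: "cover b (rev_st G) S = cover b G S"
  unfolding cover_def by (simp add: on_geodesic_converse) blast

text \<open>The properties of series-parallel digraphs that the recursion rules depend on. A walk in a
  composition that leaves an operand at a terminal cannot return, since within that operand the
  terminal has edges in one direction only.\<close>
locale two_terminal =
  fixes G :: "'a st_digraph"
  assumes finite_vertices: "finite (vertices G)"
    and edges_subset: "edges G \<subseteq> vertices G \<times> vertices G"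
    and source_in: "source G \<in> vertices G"
    and target_in: "target G \<in> vertices G"
    and source_neq_target: "source G \<noteq> target G"
    and not_into_source: "(x, source G) \<notin> edges G"
    and not_from_target: "(target G, x) \<notin> edges G"
    and from_source: "x \<in> vertices G \<Longrightarrow> (source G, x) \<in> (edges G)\<^sup>*"
    and to_target: "x \<in> vertices G \<Longrightarrow> (x, target G) \<in> (edges G)\<^sup>*"
begin

lemma two_terminal_rev_st: "two_terminal (rev_st G)"
  using edges_subset
  by unfold_locales (auto simp: finite_vertices source_in target_in source_neq_target[symmetric]
    not_into_source not_from_target rtrancl_converse from_source to_target)

lemma geodetic_set_iff_cover: "geodetic_set (dgraph G) S \<longleftrightarrow> cover False G S"
proof (cases "S \<subseteq> vertices G")
  case True
  then have "(\<exists>u\<in>S. \<exists>v\<in>S. \<exists>p. shortest_path (dgraph G) u p v \<and> w \<in> set p) \<longleftrightarrow>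
      (\<exists>u\<in>S. \<exists>v\<in>S. on_geodesic (edges G) u w v)" for w
    using ex_shortest_path_through_iff[OF edges_subset] by (meson subsetD)
  then show ?thesis
    using True on_geodesic_refl[of "edges G"] unfolding geodetic_set_def cover_def by blast
qed (auto simp: geodetic_set_def cover_def)

lemma closed_geodetic_set_iff_cover: "closed_geodetic_set G S \<longleftrightarrow> cover True G S"
proof (cases "S \<subseteq> vertices G")
  case True
  then have "(\<exists>p. shortest_path (dgraph G) u p v \<and> w \<in> set p) \<longleftrightarrow>
      on_geodesic (edges G) u w v" if "u \<in> S" for u v w
    using ex_shortest_path_through_iff[OF edges_subset] that by (meson subsetD)
  then show ?thesis
    using True unfolding closed_geodetic_set_def cover_def by simp
qed (auto simp: closed_geodetic_set_def cover_def)

lemma mgs_eq: "mgs G = cover_number False G"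
  by (simp add: mgs_def cover_number_def geodetic_set_iff_cover)

lemma cmgs_eq: "cmgs G = cover_number True G"
  by (simp add: cmgs_def cover_number_def closed_geodetic_set_iff_cover)

lemma is_dist_sp: "is_dist (edges G) (source G) (target G) (sp G)"
proof -
  have "sp G = (LEAST n. is_dist (edges G) (source G) (target G) n)"
    unfolding sp_def using ex_shortest_path_length_iff[OF edges_subset source_in] by simp
  then show ?thesis
    using LeastI_ex[OF ex_is_dist[OF from_source[OF target_in]]] by simp
qed

lemma sp_eqI: "is_dist (edges G) (source G) (target G) n \<Longrightarrow> sp G = n"
  using is_dist_sp is_dist_unique by metis

text \<open>A vertex that lies on a geodesic starting at \<open>u\<close> is reachable from \<open>u\<close>, and only the source reaches
  the source.\<close>
lemma source_in_cover:
  assumes "cover b G S"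
  shows "source G \<in> S"
proof (rule ccontr)
  assume "source G \<notin> S"
  then obtain u v n where "u \<in> S" "(u, source G) \<in> edges G ^^ n"
    using assms source_in unfolding cover_def on_geodesic_def by blast
  then have "u = source G"
    using not_into_source relpow_SucD[of u "source G"] by (cases n) auto
  with \<open>u \<in> S\<close> \<open>source G \<notin> S\<close> show False by simp
qed

lemma finite_cover: "cover b G S \<Longrightarrow> finite S"
  using finite_vertices finite_subset unfolding cover_def by blast

end

lemma target_in_cover:
  assumes "two_terminal G" "cover b G S"
  shows "target G \<in> S"
  using two_terminal.source_in_cover[OF two_terminal.two_terminal_rev_st] assms by fastforce

context two_terminal
begin

lemma cover_number_ge_2: "2 \<le> cover_number b G"
proof -
  obtain S where S: "cover b G S" "card S = cover_number b G" using ex_minimum_cover by blast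
  have "{source G, target G} \<subseteq> S"
    using source_in_cover target_in_cover[OF two_terminal_axioms] S by blast
  then have "card {source G, target G} \<le> card S" using finite_cover S by (intro card_mono) auto
  then show ?thesis using S source_neq_target by simp
qed

end

text \<open>In the initial digraph both vertices are terminals, so both lower bounds are attained by the set of
  all vertices.\<close>
lemma two_terminal_initial:
  assumes "s \<noteq> t" shows "two_terminal (initial_spd s t)"
  using assms by unfold_locales (auto simp: initial_spd_def)

lemma sp_initial:
  assumes "s \<noteq> t" shows "sp (initial_spd s t) = 1"
proof -
  interpret two_terminal "initial_spd s t" by (rule two_terminal_initial[OF assms])
  have "1 \<le> k" if "(s, t) \<in> {(s, t)} ^^ k" for k
    using that assms by (cases k) auto
  then show ?thesis
    by (intro sp_eqI) (auto simp: initial_spd_def is_dist_def)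
qed

lemma cover_number_initial:
  assumes "s \<noteq> t" shows "cover_number b (initial_spd s t) = 2"
proof -
  interpret two_terminal "initial_spd s t" by (rule two_terminal_initial[OF assms])
  show ?thesis
    using cover_number_ge_2[of b] cover_number_le[OF cover_verts, of b "initial_spd s t"] assms
    by (simp add: initial_spd_def)
qed

section \<open>Series composition\<close>

text \<open>The two operands share the vertex \<open>m\<close>, which stands for the merged target of \<open>G1\<close> and source of
  \<open>G2\<close>.\<close>
locale series_join = G1: two_terminal G1 + G2: two_terminal G2
  for G1 G2 H :: "'a st_digraph" +
  fixes m :: 'a
  assumes middle1: "target G1 = m" and middle2: "source G2 = m"
    and shared: "vertices G1 \<inter> vertices G2 = {m}"
    and vertices_H: "vertices H = vertices G1 \<union> vertices G2"
    and edges_H: "edges H = edges G1 \<union> edges G2"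
    and source_H: "source H = source G1" and target_H: "target H = target G2"
begin

lemma series_join_rev_st: "series_join (rev_st G2) (rev_st G1) (rev_st H) m"
proof -
  interpret R1: two_terminal "rev_st G1" by (rule G1.two_terminal_rev_st)
  interpret R2: two_terminal "rev_st G2" by (rule G2.two_terminal_rev_st)
  show ?thesis
    by unfold_locales (use shared in \<open>auto simp: middle1 middle2 vertices_H edges_H source_H target_H\<close>)
qed

lemma middle_in: "m \<in> vertices G1" "m \<in> vertices G2"
  using shared by auto

lemma shared_eq: "x \<in> vertices G1 \<Longrightarrow> x \<in> vertices G2 \<Longrightarrow> x = m"
  using shared by auto

lemma no_return: "(m, x) \<notin> edges G1" "(x, m) \<notin> edges G2"
  using G1.not_from_target G2.not_into_source middle1 middle2 by auto

text \<open>Walks cannot come back from the second operand: the only way is through \<open>m\<close>, which has no outgoing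
  edge in the first.\<close>
lemma relpow_from_right:
  assumes "(u, v) \<in> edges H ^^ k" "u \<in> vertices G2"
  shows "v \<in> vertices G2 \<and> (u, v) \<in> edges G2 ^^ k"
  using assms
proof (induction k arbitrary: v)
  case (Suc k)
  then obtain x where x: "x \<in> vertices G2" "(u, x) \<in> edges G2 ^^ k" "(x, v) \<in> edges H"
    by (auto elim: relpow_Suc_E)
  moreover have "(x, v) \<notin> edges G1"
    using x(1) shared_eq no_return(1)[of v] G1.edges_subset by blast
  ultimately show ?case
    using edges_H G2.edges_subset by auto
qed auto

lemma relpow_into_left:
  assumes "(u, v) \<in> edges H ^^ k" "v \<in> vertices G1"
  shows "u \<in> vertices G1 \<and> (u, v) \<in> edges G1 ^^ k"
  using series_join.relpow_from_right[OF series_join_rev_st, of v u k] assms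
  by (simp add: relpow_converse)

lemma relpow_H:
  "(u, v) \<in> edges G1 ^^ k \<Longrightarrow> (u, v) \<in> edges H ^^ k"
  "(u, v) \<in> edges G2 ^^ k \<Longrightarrow> (u, v) \<in> edges H ^^ k"
  using relpow_mono_rel[of "edges G1" "edges H"] relpow_mono_rel[of "edges G2" "edges H"] edges_H by auto

text \<open>This makes distances across \<open>m\<close> additive.\<close>
lemma relpow_across:
  assumes "(u, v) \<in> edges H ^^ k" "u \<in> vertices G1" "v \<in> vertices G2"
  shows "\<exists>i j. k = i + j \<and> (u, m) \<in> edges G1 ^^ i \<and> (m, v) \<in> edges G2 ^^ j"
  using assms
proof (induction k arbitrary: v)
  case 0
  then have "u = m" "v = m" using shared by auto
  then show ?case by (intro exI[of _ 0]) auto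
next
  case (Suc k)
  show ?case
  proof (cases "v = m")
    case True
    then show ?thesis
      using relpow_into_left[OF Suc.prems(1)] middle_in
      by (intro exI[of _ "Suc k"] exI[of _ 0]) auto
  next
    case False
    obtain x where x: "(u, x) \<in> edges H ^^ k" "(x, v) \<in> edges H"
      using Suc.prems by (auto elim: relpow_Suc_E)
    have "(x, v) \<in> edges G2"
      using x(2) False Suc.prems(3) shared G1.edges_subset edges_H by auto
    moreover then have "x \<in> vertices G2" using G2.edges_subset by auto
    with Suc.IH[OF x(1) Suc.prems(2)] obtain i j where
      "k = i + j" "(u, m) \<in> edges G1 ^^ i" "(m, x) \<in> edges G2 ^^ j" by blast
    ultimately show ?thesis
      by (intro exI[of _ i] exI[of _ "Suc j"]) auto
  qed
qed

lemma is_dist_across: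
  assumes "is_dist (edges G1) u m i" "is_dist (edges G2) m v j"
  shows "is_dist (edges H) u v (i + j)"
proof -
  have "(u, m) \<in> edges H ^^ i" "(m, v) \<in> edges H ^^ j"
    using assms relpow_H unfolding is_dist_def by blast+
  then have "(u, v) \<in> edges H ^^ (i + j)" by (rule relpow_trans)
  moreover have "i + j \<le> k" if k: "(u, v) \<in> edges H ^^ k" for k
  proof -
    have "u \<in> vertices G1" "v \<in> vertices G2"
      using assms middle_in relpow_in_verts[of u m i, OF _ G1.edges_subset]
        relpow_in_verts[of m v j, OF _ G2.edges_subset]
      unfolding is_dist_def by blast+
    then obtain i' j' where "k = i' + j'" "(u, m) \<in> edges G1 ^^ i'" "(m, v) \<in> edges G2 ^^ j'"
      using relpow_across[OF k] by blast
    then show ?thesis using assms unfolding is_dist_def by (simp add: add_mono)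
  qed
  ultimately show ?thesis by (simp add: is_dist_def)
qed

lemma is_dist_H: "is_dist (edges H) (source H) (target H) (sp G1 + sp G2)"
  using is_dist_across G1.is_dist_sp G2.is_dist_sp
  by (simp add: middle1 middle2 source_H target_H)

lemma on_geodesic_left:
  assumes "v \<in> vertices G1"
  shows "on_geodesic (edges H) u w v \<longleftrightarrow> on_geodesic (edges G1) u w v"
proof -
  have "(x, y) \<in> edges H ^^ k \<longleftrightarrow> (x, y) \<in> edges G1 ^^ k" if "y \<in> vertices G1" for x y k
    using relpow_into_left relpow_H that by blast
  moreover have "w \<in> vertices G1" if "(w, v) \<in> edges H ^^ k \<or> (w, v) \<in> edges G1 ^^ k" for k
    using that assms relpow_into_left relpow_H by blast
  ultimately show ?thesis
    using assms unfolding on_geodesic_def is_dist_def by blast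
qed

text \<open>If \<open>w\<close> lies on a geodesic from \<open>u\<close> to \<open>m\<close>, any vertex \<open>v\<close> of the second operand can take over the
  part of \<open>m\<close> as an end point, because \<open>m\<close> reaches \<open>v\<close>. This freedom of choice for \<open>v\<close> is what
  allows the forbidden end points to be avoided.\<close>
lemma on_geodesic_extend_right:
  assumes "on_geodesic (edges G1) u w m" "v \<in> vertices G2"
  shows "on_geodesic (edges H) u w v"
proof -
  obtain j where j: "is_dist (edges G2) m v j"
    using ex_is_dist[OF G2.from_source[OF assms(2)]] middle2 by blast
  obtain a b where ab: "(u, w) \<in> edges G1 ^^ a" "(w, m) \<in> edges G1 ^^ b"
    "is_dist (edges G1) u m (a + b)"
    using assms(1) unfolding on_geodesic_def by blast
  have "(w, v) \<in> edges H ^^ (b + j)"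
    using relpow_trans[OF relpow_H(1)[OF ab(2)] relpow_H(2)] j unfolding is_dist_def by blast
  with relpow_H(1)[OF ab(1)] is_dist_across[OF ab(3) j] show ?thesis
    unfolding on_geodesic_def by (intro exI[of _ a] exI[of _ "b + j"]) (simp add: add.assoc)
qed

lemma on_geodesic_middle:
  assumes "u \<in> vertices G1" "v \<in> vertices G2"
  shows "on_geodesic (edges H) u m v"
  using on_geodesic_extend_right[OF on_geodesic_end assms(2)] G1.to_target[OF assms(1)] middle1
  by blast

lemma on_geodesic_restrict_left:
  assumes "on_geodesic (edges H) u w v" "u \<in> vertices G1" "w \<in> vertices G1" "v \<in> vertices G2"
  shows "on_geodesic (edges G1) u w m"
proof -
  obtain a k where a: "(u, w) \<in> edges H ^^ a" and k: "(w, v) \<in> edges H ^^ k"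
    and uv: "is_dist (edges H) u v (a + k)"
    using assms(1) unfolding on_geodesic_def by blast
  obtain b j where bj: "k = b + j" "(w, m) \<in> edges G1 ^^ b" "(m, v) \<in> edges G2 ^^ j"
    using relpow_across[OF k assms(3,4)] by blast
  have uw: "(u, w) \<in> edges G1 ^^ a" using relpow_into_left[OF a assms(3)] by blast
  have "a + b \<le> l" if "(u, m) \<in> edges G1 ^^ l" for l
  proof -
    have "(u, v) \<in> edges H ^^ (l + j)"
      using relpow_trans[OF relpow_H(1)[OF that] relpow_H(2)[OF bj(3)]] .
    then have "a + k \<le> l + j" using uv unfolding is_dist_def by blast
    then show ?thesis using bj(1) by simp
  qed
  then have "is_dist (edges G1) u m (a + b)"
    using relpow_trans[OF uw bj(2)] by (simp add: is_dist_def)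
  then show ?thesis using uw bj(2) unfolding on_geodesic_def by blast
qed

lemma two_terminal_H: "two_terminal H"
proof
  show "finite (vertices H)" by (simp add: vertices_H G1.finite_vertices G2.finite_vertices)
  show "edges H \<subseteq> vertices H \<times> vertices H"
    using G1.edges_subset G2.edges_subset by (auto simp: vertices_H edges_H)
  show "source H \<in> vertices H" "target H \<in> vertices H"
    by (auto simp: vertices_H source_H target_H G1.source_in G2.target_in)
  have "source G1 \<notin> vertices G2"
    using shared_eq[OF G1.source_in] G1.source_neq_target middle1 by auto
  then show "source H \<noteq> target H" "(x, source H) \<notin> edges H" for x
    using G2.target_in G1.not_into_source G2.edges_subset
    unfolding source_H target_H edges_H by auto
  have "target G2 \<notin> vertices G1"
    using shared_eq[of "target G2"] G2.target_in G2.source_neq_target middle2 by auto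
  then show "(target H, x) \<notin> edges H" for x
    using G2.not_from_target G1.edges_subset unfolding target_H edges_H by auto
  have 1: "(edges G1)\<^sup>* \<subseteq> (edges H)\<^sup>*" and 2: "(edges G2)\<^sup>* \<subseteq> (edges H)\<^sup>*"
    by (intro rtrancl_mono; simp add: edges_H)+
  show "(source H, x) \<in> (edges H)\<^sup>*" if "x \<in> vertices H" for x
  proof (cases "x \<in> vertices G1")
    case True
    then show ?thesis using 1 G1.from_source source_H by auto
  next
    case False
    then have "(m, x) \<in> (edges H)\<^sup>*"
      using that 2 G2.from_source[of x] middle2 vertices_H by auto
    moreover have "(source H, m) \<in> (edges H)\<^sup>*"
      using 1 G1.from_source[OF middle_in(1)] source_H by auto
    ultimately show ?thesis by simp
  qed
  show "(x, target H) \<in> (edges H)\<^sup>*" if "x \<in> vertices H" for x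
  proof (cases "x \<in> vertices G2")
    case True
    then show ?thesis using 2 G2.to_target target_H by auto
  next
    case False
    then have "(x, m) \<in> (edges H)\<^sup>*"
      using that 1 G1.to_target[of x] middle1 vertices_H by auto
    moreover have "(m, target H) \<in> (edges H)\<^sup>*"
      using 2 G2.to_target[OF middle_in(2)] target_H by auto
    ultimately show ?thesis by simp
  qed
qed

text \<open>A geodesic that covers \<open>w\<close> in the composition either stays in the first operand or can be cut at
  \<open>m\<close>; this is why \<open>m\<close> is added to the trace. Closedness is lost if the pair becomes
  \<open>(source G1, m)\<close> after the cut.\<close>
lemma cover_restrict_left:
  assumes "cover b H S"
  shows "cover False G1 (insert m (S \<inter> vertices G1))"
  unfolding cover_def
proof (intro conjI ballI)
  show "insert m (S \<inter> vertices G1) \<subseteq> vertices G1" using middle_in by auto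
  fix w assume w: "w \<in> vertices G1 - insert m (S \<inter> vertices G1)"
  then obtain u v where uv: "u \<in> S" "v \<in> S" "on_geodesic (edges H) u w v"
    using assms vertices_H unfolding cover_def by blast
  have u: "u \<in> vertices G1"
    using uv(3) w relpow_into_left unfolding on_geodesic_def by blast
  have "\<exists>v \<in> insert m (S \<inter> vertices G1). on_geodesic (edges G1) u w v"
  proof (cases "v \<in> vertices G1")
    case True
    then show ?thesis using uv on_geodesic_left by blast
  next
    case False
    then have "v \<in> vertices G2" using uv assms vertices_H unfolding cover_def by blast
    then show ?thesis using on_geodesic_restrict_left[OF uv(3) u] w by blast
  qed
  then show "\<exists>u\<in>insert m (S \<inter> vertices G1). \<exists>v\<in>insert m (S \<inter> vertices G1).
      (False \<longrightarrow> u \<noteq> source G1 \<or> v \<noteq> target G1) \<and> on_geodesic (edges G1) u w v"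
    using u uv by blast
qed

lemma cover_restrict_right:
  assumes "cover b H S"
  shows "cover False G2 (insert m (S \<inter> vertices G2))"
  using series_join.cover_restrict_left[OF series_join_rev_st, of b S] assms by simp

text \<open>If the target is the only end point on the second side, an admissible geodesic that crosses \<open>m\<close>
  does not start at the source, for it would join the forbidden pair. Nor does one
  end in \<open>m\<close>, as \<open>m \<notin> S\<close>. So the trace is closed.\<close>
lemma closed_cover_restrict_left:
  assumes "cover True H S" "m \<notin> S" "insert m (S \<inter> vertices G2) = {m, target G2}"
  shows "cover True G1 (insert m (S \<inter> vertices G1))"
  unfolding cover_def
proof (intro conjI ballI)
  show "insert m (S \<inter> vertices G1) \<subseteq> vertices G1" using middle_in by auto
  fix w assume w: "w \<in> vertices G1 - insert m (S \<inter> vertices G1)"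
  then obtain u v where uv: "u \<in> S" "v \<in> S" "on_geodesic (edges H) u w v"
    "u \<noteq> source G1 \<or> v \<noteq> target G2"
    using coverD[OF assms(1), of w] unfolding vertices_H source_H target_H by blast
  have u: "u \<in> vertices G1"
    using uv(3) w relpow_into_left unfolding on_geodesic_def by blast
  have "\<exists>v \<in> insert m (S \<inter> vertices G1).
      (u \<noteq> source G1 \<or> v \<noteq> target G1) \<and> on_geodesic (edges G1) u w v"
  proof (cases "v \<in> vertices G1")
    case True
    moreover have "v \<noteq> target G1" using uv assms(2) middle1 by auto
    ultimately show ?thesis using uv on_geodesic_left by blast
  next
    case False
    then have v: "v \<in> vertices G2" using uv assms vertices_H unfolding cover_def by blast
    then have "v = target G2" using uv assms(2,3) by auto
    then show ?thesis using on_geodesic_restrict_left[OF uv(3) u _ v] w uv(4) by blast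
  qed
  then show "\<exists>u\<in>insert m (S \<inter> vertices G1). \<exists>v\<in>insert m (S \<inter> vertices G1).
      (True \<longrightarrow> u \<noteq> source G1 \<or> v \<noteq> target G1) \<and> on_geodesic (edges G1) u w v"
    using u uv by blast
qed

lemma closed_cover_restrict_right:
  assumes "cover True H S" "m \<notin> S" "insert m (S \<inter> vertices G1) = {m, source G1}"
  shows "cover True G2 (insert m (S \<inter> vertices G2))"
  using series_join.closed_cover_restrict_left[OF series_join_rev_st, of S] assms by simp

text \<open>The vertex \<open>m\<close> is covered by a geodesic that starts on the first side and ends on the second; if
  both traces were trivial, its end points would be the forbidden pair.\<close>
lemma closed_cover_without_middle:
  assumes "cover True H S" "m \<notin> S"
  shows "insert m (S \<inter> vertices G1) \<noteq> {m, source G1} \<or> insert m (S \<inter> vertices G2) \<noteq> {m, target G2}"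
proof -
  obtain u v where uv: "u \<in> S" "v \<in> S" "on_geodesic (edges H) u m v"
    "u \<noteq> source G1 \<or> v \<noteq> target G2"
    using coverD[OF assms(1), of m] assms(2) middle_in unfolding vertices_H source_H target_H by blast
  have "u \<in> vertices G1" "v \<in> vertices G2"
    using uv(3) relpow_into_left relpow_from_right middle_in unfolding on_geodesic_def by blast+
  then have "u \<in> insert m (S \<inter> vertices G1)" "v \<in> insert m (S \<inter> vertices G2)" "u \<noteq> m" "v \<noteq> m"
    using uv assms(2) by auto
  then show ?thesis using uv(4) by auto
qed

text \<open>A geodesic of the first operand that ends in \<open>m\<close> must get a new end point if \<open>m \<notin> S\<close>. The target of
  \<open>G2\<close> serves unless this gives the forbidden pair; the hypothesis on \<open>b\<close> names the ways out.\<close>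
lemma glue_covers_left:
  assumes S1: "cover False G1 S1" and S2: "cover False G2 S2" and S: "S1 \<union> S2 - {m} \<subseteq> S"
    and w: "w \<in> vertices G1" "w \<notin> S1"
    and b: "b \<Longrightarrow> cover True G1 S1 \<or> m \<in> S \<or> S2 \<noteq> {m, target G2}"
  shows "\<exists>u\<in>S. \<exists>v\<in>S. (b \<longrightarrow> u \<noteq> source H \<or> v \<noteq> target H) \<and> on_geodesic (edges H) u w v"
proof -
  have target: "target G2 \<in> S2" "target G2 \<noteq> m"
    using target_in_cover[OF G2.two_terminal_axioms S2] G2.source_neq_target middle2 by auto
  have m: "m \<in> S1" "m \<in> S2"
    using target_in_cover[OF G1.two_terminal_axioms S1] G2.source_in_cover[OF S2] middle1 middle2
    by auto
  obtain u v where uv: "u \<in> S1" "v \<in> S1" "on_geodesic (edges G1) u w v"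
    and escape: "b \<Longrightarrow> u \<noteq> source G1 \<or> v \<noteq> m \<or> m \<in> S \<or> S2 \<noteq> {m, target G2}"
  proof (cases "b \<and> cover True G1 S1")
    case True
    then show thesis using that coverD[of True G1 S1 w] w unfolding middle1 by blast
  next
    case False
    then show thesis using that coverD[OF S1 w] b by blast
  qed
  \<comment> \<open>No edge leaves \<open>m\<close> within \<open>G1\<close>, so a geodesic through \<open>w \<noteq> m\<close> does not start there.\<close>
  have "u \<noteq> m"
  proof
    assume "u = m"
    then obtain n where n: "(m, w) \<in> edges G1 ^^ n" using uv(3) unfolding on_geodesic_def by blast
    have "w \<noteq> m" using w m by blast
    then have "n > 0" using n by (cases n) auto
    then show False using relpow_SucD[OF n] no_return by blast
  qed
  then have u: "u \<in> S" using uv S by blast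
  have vs: "v \<in> vertices G1" using uv cover_subset[OF S1] by blast
  show ?thesis
  proof (cases "v = m \<and> m \<notin> S")
    case False
    then have "v \<in> S" using uv S by blast
    moreover have "v \<noteq> target G2" using vs shared_eq[of v] target cover_subset[OF S2] by blast
    moreover have "on_geodesic (edges H) u w v" using uv on_geodesic_left[OF vs] by simp
    ultimately show ?thesis using u target_H by auto
  next
    case True
    obtain x where x: "x \<in> S2" "x \<noteq> m" "b \<Longrightarrow> u \<noteq> source G1 \<or> x \<noteq> target G2"
    proof (cases "S2 = {m, target G2}")
      case True2: True
      then show thesis using that[of "target G2"] escape True target by blast
    next
      case False
      then obtain x where "x \<in> S2" "x \<noteq> m" "x \<noteq> target G2" using target m by blast
      then show thesis using that by blast
    qed
    then have "x \<in> S" "on_geodesic (edges H) u w x"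
      using S cover_subset[OF S2] on_geodesic_extend_right uv True by blast+
    then show ?thesis using u x(3) source_H target_H by auto
  qed
qed

lemma glue_covers_right:
  assumes S1: "cover False G1 S1" and S2: "cover False G2 S2" and S: "S1 \<union> S2 - {m} \<subseteq> S"
    and w: "w \<in> vertices G2" "w \<notin> S2"
    and b: "b \<Longrightarrow> cover True G2 S2 \<or> m \<in> S \<or> S1 \<noteq> {m, source G1}"
  shows "\<exists>u\<in>S. \<exists>v\<in>S. (b \<longrightarrow> u \<noteq> source H \<or> v \<noteq> target H) \<and> on_geodesic (edges H) u w v"
  using series_join.glue_covers_left[OF series_join_rev_st, of S2 S1 S w b] assms
  by (auto simp: Un_commute on_geodesic_converse)

text \<open>The converse of the restriction lemmas: the conditions for \<open>b\<close> are the ones found necessary above.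
  They are void if \<open>m\<close> is kept, and for \<open>b = False\<close>.\<close>
lemma cover_glue:
  assumes S1: "cover False G1 S1" and S2: "cover False G2 S2"
    and S: "S \<subseteq> vertices H" "S1 \<union> S2 - {m} \<subseteq> S"
    and left: "b \<Longrightarrow> cover True G1 S1 \<or> m \<in> S \<or> S2 \<noteq> {m, target G2}"
    and right: "b \<Longrightarrow> cover True G2 S2 \<or> m \<in> S \<or> S1 \<noteq> {m, source G1}"
    and mid: "b \<Longrightarrow> m \<in> S \<or> S1 \<noteq> {m, source G1} \<or> S2 \<noteq> {m, target G2}"
  shows "cover b H S"
  unfolding cover_def
proof (intro conjI ballI S)
  fix w assume w: "w \<in> vertices H - S"
  have s: "source G1 \<in> S1" "source G1 \<noteq> m" "m \<in> S1"
    using G1.source_in_cover[OF S1] target_in_cover[OF G1.two_terminal_axioms S1]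
      G1.source_neq_target middle1 by auto
  have t: "target G2 \<in> S2" "target G2 \<noteq> m" "m \<in> S2"
    using target_in_cover[OF G2.two_terminal_axioms S2] G2.source_in_cover[OF S2]
      G2.source_neq_target middle2 by auto
  consider "w = m" | "w \<in> vertices G1" "w \<notin> S1" | "w \<in> vertices G2" "w \<notin> S2"
    using w S vertices_H by blast
  then show "\<exists>u\<in>S. \<exists>v\<in>S. (b \<longrightarrow> u \<noteq> source H \<or> v \<noteq> target H) \<and> on_geodesic (edges H) u w v"
  proof cases
    case 1
    obtain u v where uv: "u \<in> S1" "u \<noteq> m" "v \<in> S2" "v \<noteq> m" "b \<Longrightarrow> u \<noteq> source G1 \<or> v \<noteq> target G2"
    proof (cases "S1 = {m, source G1}")
      case True
      show thesis
      proof (cases "S2 = {m, target G2}")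
        case True2: True
        then have "\<not> b" using mid True w 1 by blast
        then show thesis using that[of "source G1" "target G2"] s t by blast
      next
        case False
        then obtain v where "v \<in> S2" "v \<noteq> m" "v \<noteq> target G2" using t by blast
        then show thesis using that[of "source G1" v] s by blast
      qed
    next
      case False
      then obtain u where "u \<in> S1" "u \<noteq> m" "u \<noteq> source G1" using s by blast
      then show thesis using that[of u "target G2"] t by blast
    qed
    then have "u \<in> S" "v \<in> S" "on_geodesic (edges H) u m v"
      using S cover_subset[OF S1] cover_subset[OF S2] on_geodesic_middle by blast+
    then show ?thesis using uv(5) 1 source_H target_H by auto
  next
    case 2
    then show ?thesis using glue_covers_left[OF S1 S2 S(2) 2 left] by blast
  next
    case 3
    then show ?thesis using glue_covers_right[OF S1 S2 S(2) 3 right] by blast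
  qed
qed

text \<open>If \<open>m \<notin> S\<close>, the traces with \<open>m\<close> added count \<open>m\<close> twice in excess of \<open>S\<close>; if \<open>m \<in> S\<close>, only once. So
  keeping \<open>m\<close> costs exactly one vertex.\<close>
lemma card_parts:
  assumes "S \<subseteq> vertices H"
  shows "card (insert m (S \<inter> vertices G1)) + card (insert m (S \<inter> vertices G2)) = Suc (card (insert m S))"
proof -
  let ?S1 = "insert m (S \<inter> vertices G1)" and ?S2 = "insert m (S \<inter> vertices G2)"
  have *: "?S1 \<union> ?S2 = insert m S" "?S1 \<inter> ?S2 = {m}"
    using assms shared_eq vertices_H by blast+
  have "card ?S1 + card ?S2 = card (?S1 \<union> ?S2) + card (?S1 \<inter> ?S2)"
    using G1.finite_vertices G2.finite_vertices by (intro card_Un_Int) auto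
  then show ?thesis unfolding * by simp
qed

lemma card_glue:
  assumes "cover b1 G1 S1" "cover b2 G2 S2"
  shows "Suc (card (S1 \<union> S2)) = card S1 + card S2" "card (S1 \<union> S2 - {m}) + 2 = card S1 + card S2"
proof -
  have "m \<in> S1" "m \<in> S2"
    using target_in_cover[OF G1.two_terminal_axioms assms(1)] G2.source_in_cover[OF assms(2)]
      middle1 middle2 by auto
  then have "S1 \<inter> S2 = {m}"
    using cover_subset[OF assms(1)] cover_subset[OF assms(2)] shared_eq by blast
  moreover have fin: "finite S1" "finite S2"
    using assms G1.finite_cover G2.finite_cover by auto
  ultimately show 1: "Suc (card (S1 \<union> S2)) = card S1 + card S2"
    using card_Un_Int[of S1 S2] by simp
  moreover have "card (S1 \<union> S2) = Suc (card (S1 \<union> S2 - {m}))"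
    using fin \<open>m \<in> S1\<close> by (intro card.remove) auto
  ultimately show "card (S1 \<union> S2 - {m}) + 2 = card S1 + card S2" by simp
qed

lemma glued_subset:
  assumes "cover b1 G1 S1" "cover b2 G2 S2"
  shows "S1 \<union> S2 \<subseteq> vertices H"
  using assms[THEN cover_subset] vertices_H by blast

text \<open>Geodetic sets may always drop \<open>m\<close>, as the pair of terminals is not forbidden.\<close>
theorem cover_number_series: "cover_number False H + 2 = cover_number False G1 + cover_number False G2"
proof (rule antisym)
  obtain S1 S2 where opt: "cover False G1 S1" "card S1 = cover_number False G1"
    "cover False G2 S2" "card S2 = cover_number False G2"
    using ex_minimum_cover by metis
  then have "cover False H (S1 \<union> S2 - {m})"
    using glued_subset[OF opt(1,3)] by (intro cover_glue[OF opt(1,3)]) auto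
  from cover_number_le[OF this]
  show "cover_number False H + 2 \<le> cover_number False G1 + cover_number False G2"
    using card_glue(2)[OF opt(1,3)] opt by simp
next
  obtain S where S: "cover False H S" "card S = cover_number False H"
    using ex_minimum_cover by metis
  then have "cover_number False G1 + cover_number False G2 \<le> Suc (card (insert m S))"
    using cover_number_le[OF cover_restrict_left[OF S(1)]] cover_number_le[OF cover_restrict_right[OF S(1)]]
      card_parts[OF cover_subset[OF S(1)]] by simp
  also have "\<dots> \<le> card S + 2" using card_insert_le_m1[of "Suc (card S)" S m] by simp
  finally show "cover_number False G1 + cover_number False G2 \<le> cover_number False H + 2"
    using S by simp
qed

text \<open>Exactly in this case the composition has a closed cover that is as small as its minimum geodetic sets;
  such a cover omits \<open>m\<close>.\<close>
definition middle_redundant :: bool where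
  "middle_redundant \<longleftrightarrow> (cover_number False G1 > 2 \<and> cover_number False G2 > 2) \<or>
     (cover_number False G1 = cover_number True G1 \<and> cover_number True G1 > 2) \<or>
     (cover_number False G2 = cover_number True G2 \<and> cover_number True G2 > 2)"

text \<open>The bounds leave two candidates, one apart. If the smaller one is attained by
  \<open>S\<close>, counting forces \<open>m \<notin> S\<close> and both traces to be minimum geodetic sets; the necessary conditions
  on traces then give \<open>middle_redundant\<close>.\<close>
theorem closed_cover_number_series:
  "cover_number True H + (if middle_redundant then 2 else 1) = cover_number False G1 + cover_number False G2"
proof -
  have lower: "cover_number False G1 + cover_number False G2 \<le> cover_number True H + 2"
    using cover_number_series cover_number_mono[of False H] by simp
  have trivial1: "card S1 \<le> 2" if "S1 = {m, source G1}" for S1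
    using that by (simp add: card_insert_if)
  have trivial2: "card S2 \<le> 2" if "S2 = {m, target G2}" for S2
    using that by (simp add: card_insert_if)
  show ?thesis
  proof (cases middle_redundant)
    case True
    obtain S1 S2 where opt: "cover False G1 S1" "card S1 = cover_number False G1"
      "cover False G2 S2" "card S2 = cover_number False G2"
      and cond: "card S1 > 2 \<and> card S2 > 2 \<or> cover True G1 S1 \<and> card S1 > 2 \<or> cover True G2 S2 \<and> card S2 > 2"
    proof -
      obtain T1 T2 where T: "cover False G1 T1" "card T1 = cover_number False G1"
        "cover False G2 T2" "card T2 = cover_number False G2"
        using ex_minimum_cover by metis
      obtain C1 C2 where C: "cover True G1 C1" "card C1 = cover_number True G1"
        "cover True G2 C2" "card C2 = cover_number True G2"
        using ex_minimum_cover by metis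
      note mono = cover_mono[OF C(1), of False] cover_mono[OF C(3), of False]
      consider "cover_number False G1 > 2 \<and> cover_number False G2 > 2"
        | "cover_number False G1 = cover_number True G1 \<and> cover_number True G1 > 2"
        | "cover_number False G2 = cover_number True G2 \<and> cover_number True G2 > 2"
        using True unfolding middle_redundant_def by blast
      then show thesis
      proof cases
        case 1
        then show thesis using that[of T1 T2] T by simp
      next
        case 2
        then show thesis using that[of C1 T2] C T mono by simp
      next
        case 3
        then show thesis using that[of T1 C2] C T mono by simp
      qed
    qed
    have nontrivial: "card S1 > 2 \<Longrightarrow> S1 \<noteq> {m, source G1}" "card S2 > 2 \<Longrightarrow> S2 \<noteq> {m, target G2}"
      using trivial1[of S1] trivial2[of S2] by linarith+
    have "cover True H (S1 \<union> S2 - {m})"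
      using glued_subset[OF opt(1,3)] nontrivial cond
      by (intro cover_glue[OF opt(1,3)]) blast+
    from cover_number_le[OF this]
    have "cover_number True H + 2 \<le> cover_number False G1 + cover_number False G2"
      using card_glue(2)[OF opt(1,3)] opt by simp
    then show ?thesis using lower True by simp
  next
    case False
    obtain S1 S2 where opt: "cover False G1 S1" "card S1 = cover_number False G1"
      "cover False G2 S2" "card S2 = cover_number False G2"
      using ex_minimum_cover by metis
    have "m \<in> S1" using target_in_cover[OF G1.two_terminal_axioms opt(1)] middle1 by simp
    then have "cover True H (S1 \<union> S2)"
      using glued_subset[OF opt(1,3)] by (intro cover_glue[OF opt(1,3)]) auto
    from cover_number_le[OF this]
    have upper: "cover_number True H + 1 \<le> cover_number False G1 + cover_number False G2"
      using card_glue(1)[OF opt(1,3)] opt by simp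
    have "cover_number True H + 2 \<noteq> cover_number False G1 + cover_number False G2"
    proof
      assume eq: "cover_number True H + 2 = cover_number False G1 + cover_number False G2"
      obtain S where S: "cover True H S" "card S = cover_number True H"
        using ex_minimum_cover by metis
      let ?S1 = "insert m (S \<inter> vertices G1)" and ?S2 = "insert m (S \<inter> vertices G2)"
      have le: "cover_number False G1 \<le> card ?S1" "cover_number False G2 \<le> card ?S2"
        using cover_number_le cover_restrict_left[OF S(1)] cover_restrict_right[OF S(1)] by auto
      \<comment> \<open>Both traces have at least minimum size, so the count is tight only if \<open>m\<close> is not in \<open>S\<close>.\<close>
      have "card S + 2 \<le> Suc (card (insert m S))"
        using le card_parts[OF cover_subset[OF S(1)]] S(2) eq by simp
      then have m: "m \<notin> S" by (auto simp: insert_absorb)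
      have "finite S" using two_terminal.finite_cover[OF two_terminal_H S(1)] .
      then have card: "card ?S1 = cover_number False G1" "card ?S2 = cover_number False G2"
        using le card_parts[OF cover_subset[OF S(1)]] S(2) eq m by auto
      \<comment> \<open>A nontrivial trace contains the two terminals of its operand and a third vertex.\<close>
      have big1: "card ?S1 > 2" if "?S1 \<noteq> {m, source G1}"
      proof (rule ccontr)
        assume "\<not> card ?S1 > 2"
        moreover have "{m, source G1} \<subseteq> ?S1"
          using G1.source_in_cover[OF cover_restrict_left[OF S(1)]] by blast
        moreover have "card {m, source G1} = 2" using G1.source_neq_target middle1 by auto
        moreover have "finite ?S1" using \<open>finite S\<close> by simp
        ultimately show False using that card_seteq[of ?S1 "{m, source G1}"] by simp
      qed
      have big2: "card ?S2 > 2" if "?S2 \<noteq> {m, target G2}"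
      proof (rule ccontr)
        assume "\<not> card ?S2 > 2"
        moreover have "{m, target G2} \<subseteq> ?S2"
          using target_in_cover[OF G2.two_terminal_axioms cover_restrict_right[OF S(1)]] by blast
        moreover have "card {m, target G2} = 2" using G2.source_neq_target middle2 by auto
        moreover have "finite ?S2" using \<open>finite S\<close> by simp
        ultimately show False using that card_seteq[of ?S2 "{m, target G2}"] by simp
      qed
      have closed1: "cover_number True G1 = cover_number False G1" if "?S2 = {m, target G2}"
        using cover_number_le[OF closed_cover_restrict_left[OF S(1) m that]] card(1)
          cover_number_mono[of False G1] by simp
      have closed2: "cover_number True G2 = cover_number False G2" if "?S1 = {m, source G1}"
        using cover_number_le[OF closed_cover_restrict_right[OF S(1) m that]] card(2)
          cover_number_mono[of False G2] by simp
      consider "?S1 \<noteq> {m, source G1}" "?S2 \<noteq> {m, target G2}"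
        | "?S1 \<noteq> {m, source G1}" "?S2 = {m, target G2}"
        | "?S1 = {m, source G1}" "?S2 \<noteq> {m, target G2}"
        using closed_cover_without_middle[OF S(1) m] by argo
      then have middle_redundant
      proof cases
        case 1
        then show ?thesis using big1 big2 card unfolding middle_redundant_def by simp
      next
        case 2
        then show ?thesis using big1 closed1 card(1) unfolding middle_redundant_def by simp
      next
        case 3
        then show ?thesis using big2 closed2 card(2) unfolding middle_redundant_def by simp
      qed
      with False show False ..
    qed
    then show ?thesis using lower upper False by simp
  qed
qed

end

section \<open>Parallel composition\<close>

locale parallel_join = G1: two_terminal G1 + G2: two_terminal G2
  for G1 G2 H :: "'a st_digraph" +
  assumes source2: "source G2 = source G1" and target2: "target G2 = target G1"
    and shared: "vertices G1 \<inter> vertices G2 = {source G1, target G1}"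
    and vertices_H: "vertices H = vertices G1 \<union> vertices G2"
    and edges_H: "edges H = edges G1 \<union> edges G2"
    and source_H: "source H = source G1" and target_H: "target H = target G1"
begin

lemma parallel_join_commute: "parallel_join G2 G1 H"
  by unfold_locales (use shared in \<open>auto simp: source2 target2 vertices_H edges_H source_H target_H\<close>)

lemma shared_terminal: "x \<in> vertices G1 \<Longrightarrow> x \<in> vertices G2 \<Longrightarrow> x = source G1 \<or> x = target G1"
  using shared by blast

text \<open>An inner vertex of a walk has an incoming and an outgoing edge. A terminal does not have both, even
  if the two edges come from different operands, so a walk never changes sides.\<close>
lemma relpow_H: "(u, v) \<in> edges H ^^ k \<longleftrightarrow> (u, v) \<in> edges G1 ^^ k \<or> (u, v) \<in> edges G2 ^^ k"
proof
  assume "(u, v) \<in> edges H ^^ k"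
  then show "(u, v) \<in> edges G1 ^^ k \<or> (u, v) \<in> edges G2 ^^ k"
  proof (induction k arbitrary: v)
    case (Suc k)
    then obtain x where x: "(x, v) \<in> edges H" "(u, x) \<in> edges G1 ^^ k \<or> (u, x) \<in> edges G2 ^^ k"
      by (auto elim: relpow_Suc_E)
    show ?case
    proof (cases k)
      case 0
      then show ?thesis using x edges_H by auto
    next
      case k: (Suc n)
      have switch: False if "(y, x) \<in> edges G1" "(x, z) \<in> edges G2" for y z
        using that shared_terminal[of x] G1.edges_subset G2.edges_subset
          G1.not_into_source G2.not_from_target target2 by auto
      have switch': False if "(y, x) \<in> edges G2" "(x, z) \<in> edges G1" for y z
        using that shared_terminal[of x] G1.edges_subset G2.edges_subset
          G2.not_into_source G1.not_from_target source2 by auto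
      have "(x, v) \<in> edges G1" if "(u, x) \<in> edges G1 ^^ k"
        using relpow_SucD[OF that] k switch x(1) edges_H by blast
      moreover have "(x, v) \<in> edges G2" if "(u, x) \<in> edges G2 ^^ k"
        using relpow_SucD[OF that] k switch' x(1) edges_H by blast
      ultimately show ?thesis using x(2) by auto
    qed
  qed auto
next
  assume "(u, v) \<in> edges G1 ^^ k \<or> (u, v) \<in> edges G2 ^^ k"
  then show "(u, v) \<in> edges H ^^ k"
    using relpow_mono_rel[of "edges G1" "edges H"] relpow_mono_rel[of "edges G2" "edges H"] edges_H by auto
qed

lemma is_dist_H: "is_dist (edges H) (source H) (target H) (min (sp G1) (sp G2))"
  using G1.is_dist_sp G2.is_dist_sp
  unfolding is_dist_def relpow_H source_H target_H source2 target2 by (auto simp: min_def)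

text \<open>The other operand can only provide a competing walk between vertices of the first if these are the
  source and the target.\<close>
lemma on_geodesic_left:
  assumes w: "w \<in> vertices G1" "w \<noteq> source G1" "w \<noteq> target G1"
  shows "on_geodesic (edges H) u w v \<longleftrightarrow>
    on_geodesic (edges G1) u w v \<and> (u = source G1 \<and> v = target G1 \<longrightarrow> sp G1 \<le> sp G2)"
proof
  have w2: "w \<notin> vertices G2" using w shared_terminal by blast
  have left: "(x, y) \<in> edges G1 ^^ k" if "(x, y) \<in> edges H ^^ k" "x = w \<or> y = w" for x y k
  proof (rule ccontr)
    assume not_left: "(x, y) \<notin> edges G1 ^^ k"
    then have right: "(x, y) \<in> edges G2 ^^ k" using that relpow_H by blast
    have "k > 0" using right not_left by (cases k) auto
    then show False using relpow_SucD[OF right] that(2) w2 G2.edges_subset by blast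
  qed
  {
    assume "on_geodesic (edges H) u w v"
    then obtain a b where ab: "(u, w) \<in> edges G1 ^^ a" "(w, v) \<in> edges G1 ^^ b"
      and dist: "is_dist (edges H) u v (a + b)"
      using left unfolding on_geodesic_def by blast
    have "is_dist (edges G1) u v (a + b)"
      using dist relpow_trans[OF ab] unfolding is_dist_def relpow_H by blast
    moreover have "sp G1 \<le> sp G2" if "u = source G1 \<and> v = target G1"
    proof -
      have "sp G1 = a + b" using calculation that by (intro G1.sp_eqI) simp
      moreover have "a + b \<le> sp G2"
        using dist that G2.is_dist_sp source2 target2 unfolding is_dist_def relpow_H by auto
      ultimately show ?thesis by simp
    qed
    ultimately show "on_geodesic (edges G1) u w v \<and> (u = source G1 \<and> v = target G1 \<longrightarrow> sp G1 \<le> sp G2)"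
      using ab unfolding on_geodesic_def by blast
  next
    assume "on_geodesic (edges G1) u w v \<and> (u = source G1 \<and> v = target G1 \<longrightarrow> sp G1 \<le> sp G2)"
    then obtain a b where ab: "(u, w) \<in> edges G1 ^^ a" "(w, v) \<in> edges G1 ^^ b"
      and dist: "is_dist (edges G1) u v (a + b)"
      and sp: "u = source G1 \<and> v = target G1 \<longrightarrow> sp G1 \<le> sp G2"
      unfolding on_geodesic_def by blast
    have uv: "u \<in> vertices G1" "v \<in> vertices G1"
      using relpow_in_verts[OF ab(1) G1.edges_subset] relpow_in_verts[OF ab(2) G1.edges_subset] w(1)
      by auto
    have "a + b \<le> k" if k: "(u, v) \<in> edges G2 ^^ k" for k
    proof (cases "k = 0")
      case True
      then have "(u, v) \<in> edges G1 ^^ k" using k by auto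
      then show ?thesis using dist unfolding is_dist_def by blast
    next
      case False
      then obtain x y where xy: "(u, x) \<in> edges G2" "(y, v) \<in> edges G2"
        using relpow_SucD[OF k] by blast
      then have "u = source G1" "v = target G1"
        using uv shared_terminal G2.edges_subset G2.not_from_target G2.not_into_source source2 target2
        by (metis mem_Sigma_iff subsetD)+
      moreover then have "sp G1 = a + b" "sp G2 \<le> k"
        using dist G1.sp_eqI k G2.is_dist_sp source2 target2 unfolding is_dist_def by auto
      ultimately show ?thesis using sp by simp
    qed
    then have "is_dist (edges H) u v (a + b)"
      using dist unfolding is_dist_def relpow_H by blast
    then show "on_geodesic (edges H) u w v"
      using ab relpow_H unfolding on_geodesic_def by blast
  }
qed

lemma two_terminal_H: "two_terminal H"
proof
  show "finite (vertices H)" by (simp add: vertices_H G1.finite_vertices G2.finite_vertices)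
  show "edges H \<subseteq> vertices H \<times> vertices H"
    using G1.edges_subset G2.edges_subset by (auto simp: vertices_H edges_H)
  show "source H \<in> vertices H" "target H \<in> vertices H" "source H \<noteq> target H"
    by (auto simp: vertices_H source_H target_H G1.source_in G1.target_in G1.source_neq_target)
  show "(x, source H) \<notin> edges H" "(target H, x) \<notin> edges H" for x
    using G1.not_into_source G2.not_into_source G1.not_from_target G2.not_from_target
    by (auto simp: source_H target_H source2 target2 edges_H)
  have 1: "(edges G1)\<^sup>* \<subseteq> (edges H)\<^sup>*" and 2: "(edges G2)\<^sup>* \<subseteq> (edges H)\<^sup>*"
    by (intro rtrancl_mono; simp add: edges_H)+
  show "(source H, x) \<in> (edges H)\<^sup>*" "(x, target H) \<in> (edges H)\<^sup>*" if "x \<in> vertices H" for x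
    using that 1 2 G1.from_source[of x] G2.from_source[of x] G1.to_target[of x] G2.to_target[of x]
    unfolding source_H target_H vertices_H source2 target2 by auto
qed

lemma cover_restrict:
  assumes S: "cover b H S"
  shows "cover (b \<or> sp G2 < sp G1) G1 (S \<inter> vertices G1)"
  unfolding cover_def
proof (intro conjI ballI)
  fix w assume w: "w \<in> vertices G1 - S \<inter> vertices G1"
  have "source G1 \<in> S" "target G1 \<in> S"
    using two_terminal.source_in_cover[OF two_terminal_H S] target_in_cover[OF two_terminal_H S]
      source_H target_H by auto
  then have w': "w \<in> vertices G1" "w \<noteq> source G1" "w \<noteq> target G1" using w by auto
  obtain u v where uv: "u \<in> S" "v \<in> S" "b \<longrightarrow> u \<noteq> source G1 \<or> v \<noteq> target G1" "on_geodesic (edges H) u w v"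
    using coverD[OF S, of w] w unfolding vertices_H source_H target_H by blast
  have geo: "on_geodesic (edges G1) u w v" and sp: "u = source G1 \<and> v = target G1 \<longrightarrow> sp G1 \<le> sp G2"
    using on_geodesic_left[OF w'] uv(4) by blast+
  have "u \<in> vertices G1" "v \<in> vertices G1"
    using geo w' relpow_in_verts[OF _ G1.edges_subset] unfolding on_geodesic_def by blast+
  then show "\<exists>u\<in>S \<inter> vertices G1. \<exists>v\<in>S \<inter> vertices G1.
      (b \<or> sp G2 < sp G1 \<longrightarrow> u \<noteq> source G1 \<or> v \<noteq> target G1) \<and> on_geodesic (edges G1) u w v"
    using uv geo sp by (metis IntI leD)
qed simp

lemma glue_covers:
  assumes S: "cover (b \<or> sp G2 < sp G1) G1 (S \<inter> vertices G1)" and w: "w \<in> vertices G1" "w \<notin> S"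
  shows "\<exists>u\<in>S. \<exists>v\<in>S. (b \<longrightarrow> u \<noteq> source H \<or> v \<noteq> target H) \<and> on_geodesic (edges H) u w v"
proof -
  have w': "w \<noteq> source G1" "w \<noteq> target G1"
    using w G1.source_in_cover[OF S] target_in_cover[OF G1.two_terminal_axioms S] by auto
  obtain u v where uv: "u \<in> S" "v \<in> S" "on_geodesic (edges G1) u w v"
    "b \<or> sp G2 < sp G1 \<longrightarrow> u \<noteq> source G1 \<or> v \<noteq> target G1"
    using coverD[OF S w(1)] w by blast
  then have "on_geodesic (edges H) u w v"
    using on_geodesic_left[OF w(1) w'] by auto
  then show ?thesis using uv source_H target_H by auto
qed

text \<open>On the longer side the pair of terminals covers nothing any more, which is just the restriction
  imposed on closed covers.\<close>
lemma cover_iff: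
  "cover b H S \<longleftrightarrow> S \<subseteq> vertices H \<and>
     cover (b \<or> sp G2 < sp G1) G1 (S \<inter> vertices G1) \<and>
     cover (b \<or> sp G1 < sp G2) G2 (S \<inter> vertices G2)"
proof
  assume "cover b H S"
  then show "S \<subseteq> vertices H \<and>
     cover (b \<or> sp G2 < sp G1) G1 (S \<inter> vertices G1) \<and>
     cover (b \<or> sp G1 < sp G2) G2 (S \<inter> vertices G2)"
    using cover_restrict parallel_join.cover_restrict[OF parallel_join_commute] cover_subset by blast
next
  assume *: "S \<subseteq> vertices H \<and>
     cover (b \<or> sp G2 < sp G1) G1 (S \<inter> vertices G1) \<and>
     cover (b \<or> sp G1 < sp G2) G2 (S \<inter> vertices G2)"
  show "cover b H S"
    unfolding cover_def
  proof (intro conjI ballI)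
    fix w assume w: "w \<in> vertices H - S"
    then consider "w \<in> vertices G1" | "w \<in> vertices G2" using vertices_H by blast
    then show "\<exists>u\<in>S. \<exists>v\<in>S. (b \<longrightarrow> u \<noteq> source H \<or> v \<noteq> target H) \<and> on_geodesic (edges H) u w v"
      using glue_covers[of b S w] parallel_join.glue_covers[OF parallel_join_commute, of b S w] * w
      by cases auto
  qed (use * in simp)
qed

lemma card_parts:
  assumes "S \<subseteq> vertices H" "source G1 \<in> S" "target G1 \<in> S"
  shows "card (S \<inter> vertices G1) + card (S \<inter> vertices G2) = card S + 2"
proof -
  let ?S1 = "S \<inter> vertices G1" and ?S2 = "S \<inter> vertices G2"
  have *: "?S1 \<union> ?S2 = S" "?S1 \<inter> ?S2 = {source G1, target G1}"
    using assms shared vertices_H by blast+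
  have "card ?S1 + card ?S2 = card (?S1 \<union> ?S2) + card (?S1 \<inter> ?S2)"
    using G1.finite_vertices G2.finite_vertices by (intro card_Un_Int) auto
  then show ?thesis unfolding * using G1.source_neq_target by simp
qed

theorem cover_number_parallel:
  "cover_number b H + 2 =
     cover_number (b \<or> sp G2 < sp G1) G1 + cover_number (b \<or> sp G1 < sp G2) G2"
    (is "_ = cover_number ?b1 G1 + cover_number ?b2 G2")
proof (rule antisym)
  obtain S1 S2 where opt: "cover ?b1 G1 S1" "card S1 = cover_number ?b1 G1"
    "cover ?b2 G2 S2" "card S2 = cover_number ?b2 G2"
    using ex_minimum_cover by metis
  have st: "source G1 \<in> S1" "target G1 \<in> S1" "source G1 \<in> S2" "target G1 \<in> S2"
    using G1.source_in_cover[OF opt(1)] target_in_cover[OF G1.two_terminal_axioms opt(1)]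
      G2.source_in_cover[OF opt(3)] target_in_cover[OF G2.two_terminal_axioms opt(3)] source2 target2
    by auto
  have sub: "S1 \<subseteq> vertices G1" "S2 \<subseteq> vertices G2" using opt cover_subset by blast+
  have parts: "(S1 \<union> S2) \<inter> vertices G1 = S1" "(S1 \<union> S2) \<inter> vertices G2 = S2"
    using sub st shared_terminal by blast+
  have "S1 \<union> S2 \<subseteq> vertices H" using sub vertices_H by blast
  moreover then have "cover b H (S1 \<union> S2)"
    unfolding cover_iff parts using opt by blast
  ultimately show "cover_number b H + 2 \<le> cover_number ?b1 G1 + cover_number ?b2 G2"
    using cover_number_le[of b H "S1 \<union> S2"] card_parts[of "S1 \<union> S2"] st opt
    unfolding parts by auto
next
  obtain S where S: "cover b H S" "card S = cover_number b H"
    using ex_minimum_cover by metis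
  have "source G1 \<in> S" "target G1 \<in> S"
    using two_terminal.source_in_cover[OF two_terminal_H S(1)] target_in_cover[OF two_terminal_H S(1)]
      source_H target_H by auto
  then show "cover_number ?b1 G1 + cover_number ?b2 G2 \<le> cover_number b H + 2"
    using S card_parts[OF cover_subset[OF S(1)]]
      cover_number_le[of ?b1 G1 "S \<inter> vertices G1"] cover_number_le[of ?b2 G2 "S \<inter> vertices G2"]
    unfolding cover_iff by simp
qed

end

section \<open>Merging vertices as renaming\<close>

definition rename_st :: "('a \<Rightarrow> 'b) \<Rightarrow> 'a st_digraph \<Rightarrow> 'b st_digraph" where
  "rename_st f G = \<lparr> dgraph = \<lparr> pverts = f ` vertices G, parcs = map_prod f f ` edges G \<rparr>,
     source = f (source G), target = f (target G) \<rparr>"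

lemma rename_st_simps [simp]:
  "vertices (rename_st f G) = f ` vertices G" "edges (rename_st f G) = map_prod f f ` edges G"
  "source (rename_st f G) = f (source G)" "target (rename_st f G) = f (target G)"
  by (simp_all add: rename_st_def)

lemma relpow_map_prod:
  fixes E :: "'a rel"
  shows "(u, v) \<in> E ^^ k \<Longrightarrow> (f u, f v) \<in> (map_prod f f ` E) ^^ k"
  by (induction k arbitrary: v) (auto intro!: relcompI)

text \<open>Injectivity makes every walk in the image a lifted walk: consecutive edges of the image come from
  edges that meet in one and the same vertex.\<close>
lemma relpow_map_prodD:
  fixes E :: "'a rel"
  assumes "(f u, y) \<in> (map_prod f f ` E) ^^ k" "u \<in> V" "inj_on f V" "E \<subseteq> V \<times> V"
  shows "\<exists>v \<in> V. y = f v \<and> (u, v) \<in> E ^^ k"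
  using assms(1)
proof (induction k arbitrary: y)
  case 0
  then show ?case using assms(2) by auto
next
  case (Suc k)
  then obtain z where "(f u, z) \<in> (map_prod f f ` E) ^^ k" "(z, y) \<in> map_prod f f ` E"
    by (auto elim: relpow_Suc_E)
  moreover from this(2) obtain a b where ab: "(a, b) \<in> E" "z = f a" "y = f b" by auto
  ultimately obtain x where x: "x \<in> V" "z = f x" "(u, x) \<in> E ^^ k"
    using Suc.IH by blast
  have "a \<in> V" "b \<in> V" using ab assms(4) by auto
  moreover then have "x = a" using x ab assms(3) by (metis inj_onD)
  ultimately show ?case using x ab by (intro bexI[of _ b]) auto
qed

context two_terminal
begin

context
  fixes f :: "'a \<Rightarrow> 'b"
  assumes inj: "inj_on f (vertices G)"
begin

lemma relpow_rename_st:
  assumes "u \<in> vertices G" "v \<in> vertices G"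
  shows "(f u, f v) \<in> edges (rename_st f G) ^^ k \<longleftrightarrow> (u, v) \<in> edges G ^^ k"
proof
  assume "(f u, f v) \<in> edges (rename_st f G) ^^ k"
  then obtain v' where "v' \<in> vertices G" "f v = f v'" "(u, v') \<in> edges G ^^ k"
    using relpow_map_prodD[OF _ assms(1) inj edges_subset] by (metis rename_st_simps(2))
  then show "(u, v) \<in> edges G ^^ k" using inj assms(2) by (metis inj_onD)
qed (auto intro: relpow_map_prod)

lemma is_dist_rename_st:
  assumes "u \<in> vertices G" "v \<in> vertices G"
  shows "is_dist (edges (rename_st f G)) (f u) (f v) n \<longleftrightarrow> is_dist (edges G) u v n"
  unfolding is_dist_def relpow_rename_st[OF assms] ..

lemma on_geodesic_rename_st:
  assumes "u \<in> vertices G" "w \<in> vertices G" "v \<in> vertices G"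
  shows "on_geodesic (edges (rename_st f G)) (f u) (f w) (f v) \<longleftrightarrow> on_geodesic (edges G) u w v"
  unfolding on_geodesic_def relpow_rename_st[OF assms(1,2)] relpow_rename_st[OF assms(2,3)]
    is_dist_rename_st[OF assms(1,3)] ..

lemma two_terminal_rename_st: "two_terminal (rename_st f G)"
proof
  let ?H = "rename_st f G"
  show "finite (vertices ?H)" using finite_vertices by simp
  show "edges ?H \<subseteq> vertices ?H \<times> vertices ?H" using edges_subset by auto
  show "source ?H \<in> vertices ?H" "target ?H \<in> vertices ?H" using source_in target_in by auto
  show "source ?H \<noteq> target ?H"
    using inj source_in target_in source_neq_target by (auto dest: inj_onD)
  show "(x, source ?H) \<notin> edges ?H" for x
  proof
    assume "(x, source ?H) \<in> edges ?H"
    then obtain a b where "(a, b) \<in> edges G" "f b = f (source G)" by auto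
    then show False using edges_subset inj source_in not_into_source[of a] by (auto dest: inj_onD)
  qed
  show "(target ?H, x) \<notin> edges ?H" for x
  proof
    assume "(target ?H, x) \<in> edges ?H"
    then obtain a b where "(a, b) \<in> edges G" "f a = f (target G)" by auto
    then show False using edges_subset inj target_in not_from_target[of b] by (auto dest: inj_onD)
  qed
  have walk: "(f u, f v) \<in> (edges ?H)\<^sup>*" if "(u, v) \<in> (edges G)\<^sup>*" for u v
    using that relpow_map_prod[of u v _ "edges G" f] unfolding rtrancl_power by auto
  show "(source ?H, x) \<in> (edges ?H)\<^sup>*" "(x, target ?H) \<in> (edges ?H)\<^sup>*" if "x \<in> vertices ?H" for x
    using that walk from_source to_target by auto
qed

lemma sp_rename_st: "sp (rename_st f G) = sp G"
  using is_dist_rename_st[OF source_in target_in, of "sp G"] is_dist_sp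
  by (intro two_terminal.sp_eqI[OF two_terminal_rename_st]) simp

lemma cover_rename_st:
  assumes "S \<subseteq> vertices G"
  shows "cover b (rename_st f G) (f ` S) \<longleftrightarrow> cover b G S"
proof -
  have out: "f w \<in> f ` S \<longleftrightarrow> w \<in> S" if "w \<in> vertices G" for w
    using that assms inj by (metis inj_on_image_mem_iff)
  have eq: "(f u \<noteq> f (source G) \<or> f v \<noteq> f (target G)) \<longleftrightarrow> (u \<noteq> source G \<or> v \<noteq> target G)"
    if "u \<in> vertices G" "v \<in> vertices G" for u v
    using that inj source_in target_in by (metis inj_onD)
  define P where "P w' \<longleftrightarrow> (\<exists>x\<in>f ` S. \<exists>y\<in>f ` S.
    (b \<longrightarrow> x \<noteq> f (source G) \<or> y \<noteq> f (target G)) \<and> on_geodesic (edges (rename_st f G)) x w' y)" for w'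
  define Q where "Q w \<longleftrightarrow> (\<exists>u\<in>S. \<exists>v\<in>S.
    (b \<longrightarrow> u \<noteq> source G \<or> v \<noteq> target G) \<and> on_geodesic (edges G) u w v)" for w
  have PQ: "P (f w) \<longleftrightarrow> Q w" if w: "w \<in> vertices G" for w
  proof -
    have "(b \<longrightarrow> f u \<noteq> f (source G) \<or> f v \<noteq> f (target G)) \<and>
          on_geodesic (edges (rename_st f G)) (f u) (f w) (f v) \<longleftrightarrow>
        (b \<longrightarrow> u \<noteq> source G \<or> v \<noteq> target G) \<and> on_geodesic (edges G) u w v"
      if "u \<in> S" "v \<in> S" for u v
    proof -
      have "u \<in> vertices G" "v \<in> vertices G" using that assms by auto
      then show ?thesis using eq on_geodesic_rename_st w by simp
    qed
    then show ?thesis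
      unfolding P_def Q_def by (simp del: rename_st_simps(2) cong: bex_cong)
  qed
  have "cover b (rename_st f G) (f ` S) \<longleftrightarrow>
      f ` S \<subseteq> f ` vertices G \<and> (\<forall>w' \<in> f ` vertices G - f ` S. P w')"
    unfolding cover_def P_def by simp
  also have "\<dots> \<longleftrightarrow> S \<subseteq> vertices G \<and> (\<forall>w \<in> vertices G - S. Q w)"
    using assms out PQ by blast
  also have "\<dots> \<longleftrightarrow> cover b G S"
    unfolding cover_def Q_def ..
  finally show ?thesis .
qed

lemma cover_number_rename_st: "cover_number b (rename_st f G) = cover_number b G"
proof (rule antisym)
  obtain S where S: "cover b G S" "card S = cover_number b G" using ex_minimum_cover by metis
  then have "card (f ` S) = card S"
    using cover_subset inj by (intro card_image) (blast intro: inj_on_subset)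
  moreover have "cover b (rename_st f G) (f ` S)"
    using S(1) cover_rename_st[OF cover_subset[OF S(1)]] by blast
  ultimately show "cover_number b (rename_st f G) \<le> cover_number b G"
    using S cover_number_le by metis
next
  obtain T where T: "cover b (rename_st f G) T" "card T = cover_number b (rename_st f G)"
    using ex_minimum_cover by metis
  then obtain S where S: "S \<subseteq> vertices G" "T = f ` S"
    using cover_subset[OF T(1)] by (auto simp: subset_image_iff)
  then have "card T = card S"
    using inj by (auto intro!: card_image intro: inj_on_subset)
  moreover have "cover b G S"
    using T(1) S cover_rename_st by blast
  ultimately show "cover_number b G \<le> cover_number b (rename_st f G)"
    using T cover_number_le by metis
qed

end

end

text \<open>Merging discards a loop at \<open>u'\<close>, whereas the image would turn it into a loop at \<open>u\<close>; hence the
  hypothesis.\<close>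
lemma merge_eq_image:
  assumes "(u', u') \<notin> E"
  shows "merge u' u E = map_prod (id(u' := u)) (id(u' := u)) ` E"
proof (intro set_eqI iffI)
  fix e assume "e \<in> merge u' u E"
  then consider v w where "e = (v, w)" "v \<noteq> u'" "w \<noteq> u'" "(v, w) \<in> E"
    | v where "e = (v, u)" "v \<noteq> u'" "(v, u') \<in> E" | w where "e = (u, w)" "w \<noteq> u'" "(u', w) \<in> E"
    unfolding merge_def by blast
  then show "e \<in> map_prod (id(u' := u)) (id(u' := u)) ` E"
    by cases force+
next
  fix e assume "e \<in> map_prod (id(u' := u)) (id(u' := u)) ` E"
  then obtain a b where "(a, b) \<in> E" "e = ((id(u' := u)) a, (id(u' := u)) b)" by auto
  then show "e \<in> merge u' u E"
    using assms unfolding merge_def by (cases "a = u'"; cases "b = u'") auto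
qed

lemma image_id_outside:
  assumes "E \<subseteq> V \<times> V" "\<And>x. x \<in> V \<Longrightarrow> f x = x"
  shows "map_prod f f ` E = E"
proof -
  have "map_prod f f ` E = id ` E"
    using assms by (intro image_cong) auto
  then show ?thesis by simp
qed

lemma series_join_series_comp:
  assumes G: "two_terminal G" and G': "two_terminal G'" and disj: "vertices G \<inter> vertices G' = {}"
  shows "series_join G (rename_st (id(source G' := target G)) G') (series_comp G G') (target G)"
    and "inj_on (id(source G' := target G)) (vertices G')"
proof -
  interpret G: two_terminal G by (rule G)
  interpret G': two_terminal G' by (rule G')
  let ?f = "id(source G' := target G)"
  have out: "target G \<notin> vertices G'" "source G' \<notin> vertices G"
    using disj G.target_in G'.source_in by blast+
  show inj: "inj_on ?f (vertices G')"
    using out by (auto simp: inj_on_def)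
  interpret R: two_terminal "rename_st ?f G'" by (rule G'.two_terminal_rename_st[OF inj])
  have unmoved: "map_prod ?f ?f ` edges G = edges G"
    using out by (intro image_id_outside[OF G.edges_subset]) auto
  have img: "?f ` vertices G' = insert (target G) (vertices G' - {source G'})"
    using G'.source_in by (auto simp: image_iff)
  have "(source G', source G') \<notin> edges G \<union> edges G'"
    using out G'.not_into_source G.edges_subset by auto
  then have edges: "edges (series_comp G G') = edges G \<union> map_prod ?f ?f ` edges G'"
    unfolding series_comp_def by (simp add: merge_eq_image image_Un unmoved)
  show "series_join G (rename_st ?f G') (series_comp G G') (target G)"
  proof
    show "vertices G \<inter> vertices (rename_st ?f G') = {target G}"
      unfolding rename_st_simps img using disj G.target_in by auto
    show "vertices (series_comp G G') = vertices G \<union> vertices (rename_st ?f G')"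
      unfolding rename_st_simps img using out G.target_in by (auto simp: series_comp_def)
    show "target (series_comp G G') = target (rename_st ?f G')"
      using G'.source_neq_target by (simp add: series_comp_def)
  qed (use edges in \<open>simp_all add: series_comp_def\<close>)
qed

text \<open>The composition performs two mergings in turn. They combine into one renaming, because the
  terminals of the first operand are not vertices of the second.\<close>
lemma parallel_join_parallel_comp:
  assumes G: "two_terminal G" and G': "two_terminal G'" and disj: "vertices G \<inter> vertices G' = {}"
  shows "parallel_join G (rename_st (id(source G' := source G, target G' := target G)) G') (parallel_comp G G')"
    and "inj_on (id(source G' := source G, target G' := target G)) (vertices G')"
proof -
  interpret G: two_terminal G by (rule G)
  interpret G': two_terminal G' by (rule G')
  let ?f = "id(source G' := source G, target G' := target G)"
  let ?g = "id(source G' := source G)" and ?h = "id(target G' := target G)"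
  have out: "target G \<notin> vertices G'" "source G' \<notin> vertices G" "source G \<notin> vertices G'" "target G' \<notin> vertices G"
    using disj G.target_in G'.source_in G.source_in G'.target_in by blast+
  show inj: "inj_on ?f (vertices G')"
    using out G.source_neq_target by (auto simp: inj_on_def)
  interpret R: two_terminal "rename_st ?f G'" by (rule G'.two_terminal_rename_st[OF inj])
  have unmoved: "map_prod ?f ?f ` edges G = edges G"
    using out by (intro image_id_outside[OF G.edges_subset]) auto
  have img: "?f ` vertices G' = insert (source G) (insert (target G) (vertices G' - {source G', target G'}))"
    using G'.source_in G'.target_in G'.source_neq_target by (auto simp: image_iff)
  have comp: "?g \<circ> ?h = ?f"
    using out G.target_in by (auto simp: fun_eq_iff)
  have loops: "(target G', target G') \<notin> edges G \<union> edges G'"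
    using out G'.not_from_target G.edges_subset by auto
  have "(source G', source G') \<notin> map_prod ?h ?h ` (edges G \<union> edges G')"
  proof
    assume "(source G', source G') \<in> map_prod ?h ?h ` (edges G \<union> edges G')"
    then obtain e where e: "e \<in> edges G \<union> edges G'" "(source G', source G') = map_prod ?h ?h e"
      by (rule imageE)
    obtain a b where ab: "e = (a, b)" by (cases e)
    then have "?h b = source G'" using e(2) by (metis map_prod_simp prod.inject)
    then have "b = source G'" using out G'.source_in by (auto split: if_splits)
    then show False using e ab out G'.not_into_source G.edges_subset by auto
  qed
  then have "edges (parallel_comp G G') = map_prod ?f ?f ` (edges G \<union> edges G')"
    unfolding parallel_comp_def comp[symmetric] map_prod.comp[symmetric] image_comp[symmetric]
    by (simp add: merge_eq_image[OF loops] merge_eq_image)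
  then have edges: "edges (parallel_comp G G') = edges G \<union> map_prod ?f ?f ` edges G'"
    by (simp only: image_Un unmoved)
  show "parallel_join G (rename_st ?f G') (parallel_comp G G')"
  proof
    show "vertices G \<inter> vertices (rename_st ?f G') = {source G, target G}"
      unfolding rename_st_simps img using disj G.target_in G.source_in by auto
    show "vertices (parallel_comp G G') = vertices G \<union> vertices (rename_st ?f G')"
      unfolding rename_st_simps img using out G.target_in G.source_in by (auto simp: parallel_comp_def)
  qed (use edges G'.source_neq_target in \<open>simp_all add: parallel_comp_def\<close>)
qed

lemma two_terminal_sp_digraph: "sp_digraph G \<Longrightarrow> two_terminal G"
proof (induction rule: sp_digraph.induct)
  case (initial s t)
  then show ?case by (rule two_terminal_initial)
next
  case (series G G')
  show ?case by (rule series_join.two_terminal_H[OF series_join_series_comp(1)[OF series.IH series.hyps(3)]])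
next
  case (parallel G G')
  show ?case by (rule parallel_join.two_terminal_H[OF parallel_join_parallel_comp(1)[OF parallel.IH parallel.hyps(3)]])
qed

lemma series_comp_numbers:
  assumes G: "two_terminal G" and G': "two_terminal G'" and disj: "vertices G \<inter> vertices G' = {}"
  shows "sp (series_comp G G') = sp G + sp G'"
    and "mgs (series_comp G G') + 2 = mgs G + mgs G'"
    and "cmgs (series_comp G G') +
        (if (mgs G > 2 \<and> mgs G' > 2) \<or> (mgs G = cmgs G \<and> cmgs G > 2) \<or>
            (mgs G' = cmgs G' \<and> cmgs G' > 2) then 2 else 1) = mgs G + mgs G'"
proof -
  note inj = series_join_series_comp(2)[OF assms]
  note rename = two_terminal.sp_rename_st[OF G' inj] two_terminal.cover_number_rename_st[OF G' inj]
  interpret J: series_join G "rename_st (id(source G' := target G)) G'" "series_comp G G'" "target G"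
    by (rule series_join_series_comp(1)[OF assms])
  note numbers = two_terminal.mgs_eq[OF J.two_terminal_H] two_terminal.cmgs_eq[OF J.two_terminal_H]
    two_terminal.mgs_eq[OF G] two_terminal.cmgs_eq[OF G]
    two_terminal.mgs_eq[OF G'] two_terminal.cmgs_eq[OF G']
  show "sp (series_comp G G') = sp G + sp G'"
    using two_terminal.sp_eqI[OF J.two_terminal_H J.is_dist_H] rename by simp
  show "mgs (series_comp G G') + 2 = mgs G + mgs G'"
    using J.cover_number_series rename unfolding numbers by simp
  show "cmgs (series_comp G G') +
        (if (mgs G > 2 \<and> mgs G' > 2) \<or> (mgs G = cmgs G \<and> cmgs G > 2) \<or>
            (mgs G' = cmgs G' \<and> cmgs G' > 2) then 2 else 1) = mgs G + mgs G'"
    using J.closed_cover_number_series unfolding J.middle_redundant_def numbers rename .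
qed

lemma parallel_comp_numbers:
  assumes G: "two_terminal G" and G': "two_terminal G'" and disj: "vertices G \<inter> vertices G' = {}"
  shows "sp (parallel_comp G G') = min (sp G) (sp G')"
    and "mgs (parallel_comp G G') + 2 =
      (if sp G' < sp G then cmgs G else mgs G) + (if sp G < sp G' then cmgs G' else mgs G')"
    and "cmgs (parallel_comp G G') + 2 = cmgs G + cmgs G'"
proof -
  note inj = parallel_join_parallel_comp(2)[OF assms]
  note rename = two_terminal.sp_rename_st[OF G' inj] two_terminal.cover_number_rename_st[OF G' inj]
  interpret J: parallel_join G "rename_st (id(source G' := source G, target G' := target G)) G'"
    "parallel_comp G G'"
    by (rule parallel_join_parallel_comp(1)[OF assms])
  note numbers = two_terminal.mgs_eq[OF J.two_terminal_H] two_terminal.cmgs_eq[OF J.two_terminal_H]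
    two_terminal.mgs_eq[OF G] two_terminal.cmgs_eq[OF G]
    two_terminal.mgs_eq[OF G'] two_terminal.cmgs_eq[OF G']
  show "sp (parallel_comp G G') = min (sp G) (sp G')"
    using two_terminal.sp_eqI[OF J.two_terminal_H J.is_dist_H] rename by simp
  show "mgs (parallel_comp G G') + 2 =
      (if sp G' < sp G then cmgs G else mgs G) + (if sp G < sp G' then cmgs G' else mgs G')"
    using J.cover_number_parallel[of False] unfolding numbers rename by simp
  show "cmgs (parallel_comp G G') + 2 = cmgs G + cmgs G'"
    using J.cover_number_parallel[of True] unfolding numbers rename by simp
qed

theorem theorem5:
  shows
   "(\<forall>s t :: 'a. s \<noteq> t \<longrightarrow>
       sp (initial_spd s t) = 1 \<and>
       mgs (initial_spd s t) = 2 \<and>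
       cmgs (initial_spd s t) = 2) \<and>
    (\<forall>G G' :: 'a st_digraph.
       sp_digraph G \<and> sp_digraph G' \<and> pverts (dgraph G) \<inter> pverts (dgraph G') = {} \<longrightarrow>
       sp (series_comp G G') = sp G + sp G' \<and>
       int (mgs (series_comp G G')) = int (mgs G) + int (mgs G') - 2 \<and>
       int (cmgs (series_comp G G')) =
         (if (mgs G > 2 \<and> mgs G' > 2) \<or>
             (mgs G = cmgs G \<and> cmgs G > 2) \<or>
             (mgs G' = cmgs G' \<and> cmgs G' > 2)
          then int (mgs G) + int (mgs G') - 2
          else int (mgs G) + int (mgs G') - 1)) \<and>
    (\<forall>G G' :: 'a st_digraph.
       sp_digraph G \<and> sp_digraph G' \<and> pverts (dgraph G) \<inter> pverts (dgraph G') = {} \<longrightarrow>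
       sp (parallel_comp G G') = min (sp G) (sp G') \<and>
       int (mgs (parallel_comp G G')) =
         (if sp G = sp G' then int (mgs G) + int (mgs G') - 2
          else if sp G < sp G' then int (mgs G) + int (cmgs G') - 2
          else int (cmgs G) + int (mgs G') - 2) \<and>
       int (cmgs (parallel_comp G G')) = int (cmgs G) + int (cmgs G') - 2)"
proof -
  have initial: "sp (initial_spd s t) = 1 \<and> mgs (initial_spd s t) = 2 \<and> cmgs (initial_spd s t) = 2"
    if "s \<noteq> t" for s t :: 'a
    using sp_initial[OF that] cover_number_initial[OF that] two_terminal.mgs_eq two_terminal.cmgs_eq
      two_terminal_initial[OF that] by metis
  show ?thesis
  proof (intro conjI allI impI; (elim conjE)?)
    fix G G' :: "'a st_digraph"
    assume "sp_digraph G" "sp_digraph G'" and disj: "vertices G \<inter> vertices G' = {}"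
    then have *: "two_terminal G" "two_terminal G'" by (simp_all add: two_terminal_sp_digraph)
    note series = series_comp_numbers[OF * disj]
    show "sp (series_comp G G') = sp G + sp G'" by (rule series)
    show "int (mgs (series_comp G G')) = int (mgs G) + int (mgs G') - 2"
      using series(2) by linarith
    show "int (cmgs (series_comp G G')) =
        (if (mgs G > 2 \<and> mgs G' > 2) \<or> (mgs G = cmgs G \<and> cmgs G > 2) \<or>
            (mgs G' = cmgs G' \<and> cmgs G' > 2)
         then int (mgs G) + int (mgs G') - 2 else int (mgs G) + int (mgs G') - 1)"
      using series(3) by (simp split: if_splits)
    note parallel = parallel_comp_numbers[OF * disj]
    show "sp (parallel_comp G G') = min (sp G) (sp G')" by (rule parallel)
    show "int (mgs (parallel_comp G G')) =
        (if sp G = sp G' then int (mgs G) + int (mgs G') - 2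
         else if sp G < sp G' then int (mgs G) + int (cmgs G') - 2
         else int (cmgs G) + int (mgs G') - 2)"
      using parallel(2) by (auto split: if_splits)
    show "int (cmgs (parallel_comp G G')) = int (cmgs G) + int (cmgs G') - 2"
      using parallel(3) by linarith
  qed (use initial in auto)
qed

end
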